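(* Let $p(\cdot)\in\mathcal{P}(\mathbb{R})$ satisfy at least one of: $p_+<\infty$; or $1/p(\cdot)$ is log-Hölder continuous at infinity with limit $1$ (i.e. there is $C>0$ with $\left|\frac{1}{p(x)}-1\right|\le \frac{C}{\log(e+|x|)}$ for almost every $x\in\mathbb{R}$). Let $q(\cdot)$ be its conjugate exponent. Let $f\in L^{p(\cdot)}(\mathbb{R})$, and let $g\in\mathcal{B}V(\mathbb{R})$ with $g(\pm\infty)=0$ be such that $\int_{-\infty}^\infty|s|^{1/p_-}|dg(s)|<\infty$. Then $\widehat{g}\in L^{q(\cdot)}(\mathbb{R})$ and $$\int_{-\infty}^\infty\widehat{f}\,g=\int_{-\infty}^\infty f(s)\widehat{g}(s)\,ds.$$ Moreover, $$\left|\int_{-\infty}^\infty\widehat{f}\,g\right|\le\|f\|_{p(\cdot)}\left(K_1\int_0^M|s|^{1/r}|dg(s)|+K_2\int_M^\infty|s|^{1/p_-}|dg(s)|\right),$$ for some $K_1,K_2,M>0$ and $r\ge1$ depending only on $p(\cdot)$.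
   Context: $\mathcal{P}(\mathbb{R})$ is the set of measurable functions $p(\cdot):\mathbb{R}\to[1,\infty]$ (exponent functions), and $p_-=\operatorname{ess\,inf} p$, $p_+=\operatorname{ess\,sup} p$. The conjugate exponent $q(\cdot)$ is given by $\frac1{p(x)}+\frac1{q(x)}=1$, with $1/\infty=0$. Let $\mathbb{R}_\infty^{p(\cdot)}=\{x: p(x)=\infty\}$. The modular is $\rho_{p(\cdot)}(f)=\int_{\mathbb{R}\setminus \mathbb{R}_\infty^{p(\cdot)}}|f(x)|^{p(x)}dx+\|f\|_{L^\infty(\mathbb{R}_\infty^{p(\cdot)})}\in[0,\infty]$. $L^{p(\cdot)}(\mathbb{R})$ is the space of Lebesgue measurable functions $f$ on $\mathbb{R}$, identified when equal almost everywhere, with $\rho_{p(\cdot)}(f/\lambda)<\infty$ for some $\lambda>0$, with norm $\|f\|_{p(\cdot)}=\inf\{\lambda>0:\rho_{p(\cdot)}(f/\lambda)\le 1\}$; $L^{q(\cdot)}(\mathbb{R})$ is defined in the same way. For $f\in L^{p(\cdot)}(\mathbb{R})$, $\Psi_f(s)=\int_{-\infty}^{\infty}\left(\frac{1-e^{-ist}}{it}\right)f(t)\,dt$ for $s\ne0$ and $\Psi_f(0)=0$. The Fourier transform of $f$ is the distributional derivative $\widehat{f}:=\Psi_f'$. $\mathcal{B}V(\mathbb{R})$ is the set of functions of bounded variation on $\mathbb{R}$; $g(\pm\infty):=\lim_{x\to\pm\infty}g(x)$. For $g\in\mathcal{B}V(\mathbb{R})$ with $g(x)=o(|x|^{-1/p_-})$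 as $|x|\to\infty$, the (continuous primitive) integral of $\widehat f$ against $g$ is defined by $$\int_{-\infty}^{\infty}\widehat{f}\,g:=-\int_{-\infty}^\infty\Psi_f(t)\,dg(t),$$ the right-hand side being a Henstock–Stieltjes integral. $|dg|$ denotes integration with respect to the total variation of $g$. For $g$ as in the claim, $\widehat{g}(t)=\int_{-\infty}^\infty e^{-ist}g(s)\,ds$ (as an improper integral, for $t\neq 0$).
   Formalization: In the final estimate the integrals from 0 to M and from M to infinity are taken over |s| ≤ M and |s| > M, negative s included; as printed (s > 0 only) the bound fails, e.g. for p = 2 and g the indicator of [-2,-1]. *)

theory Defs
  imports
    "HOL-Analysis.Analysis"
    "HOL-Library.Landau_Symbols"
    "HOL-Probability.Essential_Supremum"
begin

section \<open>Variable exponent Lebesgue spaces on the real line\<close>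

definition exponent_function :: "(real \<Rightarrow> ennreal) \<Rightarrow> bool" where
  "exponent_function p \<longleftrightarrow> p \<in> borel_measurable lebesgue \<and> (\<forall>x. 1 \<le> p x)"

definition essinf :: "'a measure \<Rightarrow> ('a \<Rightarrow> ennreal) \<Rightarrow> ennreal" where
  "essinf M p = Sup {z. AE x in M. z \<le> p x}"

text \<open>The real number \<open>1 / p\<^sub>-\<close>, with \<open>1 / \<infinity> = 0\<close>.\<close>

definition inv_p_minus :: "(real \<Rightarrow> ennreal) \<Rightarrow> real" where
  "inv_p_minus p = enn2real (1 / essinf lebesgue p)"

text \<open>In \<^typ>\<open>ennreal\<close> we have \<open>1 / \<infinity> = 0\<close>, and \<open>1 / x = 0\<close> only for \<open>x = \<infinity>\<close>.\<close>

definition conjugate_exponents :: "(real \<Rightarrow> ennreal) \<Rightarrow> (real \<Rightarrow> ennreal) \<Rightarrow> bool" where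
  "conjugate_exponents p q \<longleftrightarrow> (\<forall>x. 1 / p x + 1 / q x = 1)"

definition log_Hoelder_at_infinity :: "(real \<Rightarrow> ennreal) \<Rightarrow> real \<Rightarrow> bool" where
  "log_Hoelder_at_infinity p l \<longleftrightarrow>
     (\<exists>C>0. AE x in lebesgue. \<bar>enn2real (1 / p x) - l\<bar> \<le> C / ln (exp 1 + \<bar>x\<bar>))"

definition modular :: "(real \<Rightarrow> ennreal) \<Rightarrow> (real \<Rightarrow> complex) \<Rightarrow> ennreal" where
  "modular p f =
     (\<integral>\<^sup>+x\<in>{x. p x \<noteq> \<infinity>}. ennreal (norm (f x) powr enn2real (p x)) \<partial>lebesgue)
     + esssup (lebesgue_on {x. p x = \<infinity>}) (\<lambda>x. ennreal (norm (f x)))"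

text \<open>Elements of the space are represented by functions; no quotient by a.e. equality is formed.\<close>

definition Lvar :: "(real \<Rightarrow> ennreal) \<Rightarrow> (real \<Rightarrow> complex) set" where
  "Lvar p = {f. f \<in> borel_measurable lebesgue \<and> (\<exists>c>0. modular p (\<lambda>x. f x / of_real c) < \<infinity>)}"

definition Lvar_norm :: "(real \<Rightarrow> ennreal) \<Rightarrow> (real \<Rightarrow> complex) \<Rightarrow> real" where
  "Lvar_norm p f = Inf {c. c > 0 \<and> modular p (\<lambda>x. f x / of_real c) \<le> 1}"


section \<open>Functions of bounded variation\<close>

definition variation :: "(real \<Rightarrow> complex) \<Rightarrow> real set \<Rightarrow> ennreal" where
  "variation g S =
     (SUP (n, x) \<in> {(n :: nat, x :: nat \<Rightarrow> real). mono x \<and> range x \<subseteq> S}.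
        \<Sum>i<n. ennreal (norm (g (x (Suc i)) - g (x i))))"

definition bounded_variation :: "(real \<Rightarrow> complex) \<Rightarrow> bool" where
  "bounded_variation g \<longleftrightarrow> variation g UNIV < \<infinity>"

definition variation_function :: "(real \<Rightarrow> complex) \<Rightarrow> real \<Rightarrow> real" where
  "variation_function g x = enn2real (variation g {..x})"

text \<open>
  The measure \<open>|dg|\<close>: the Lebesgue--Stieltjes measure of the (increasing) variation function \<open>V\<close>.
  As \<^const>\<open>interval_measure\<close> expects a right-continuous function, \<open>V\<close> is replaced by
  its right limits \<open>V(x+)\<close>; the atom at \<open>x\<close> has mass \<open>V(x+) - V(x-)\<close>.
\<close>

definition variation_measure :: "(real \<Rightarrow> complex) \<Rightarrow> real measure" where
  "variation_measure g = interval_measure (\<lambda>x. Lim (at_right x) (variation_function g))"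


section \<open>The Henstock--Stieltjes integral\<close>

text \<open>
  As for \<^const>\<open>has_integral\<close>: a gauge limit of Stieltjes sums on compact intervals, and a limit
  of these integrals on the whole line.  By Hake's theorem the latter agrees with the gauge integral
  over the extended real line under the usual convention that the integrand is \<open>0\<close> at
  \<open>\<plusminus>\<infinity>\<close>.
\<close>

definition has_HS_integral_on ::
    "(real \<Rightarrow> complex) \<Rightarrow> (real \<Rightarrow> complex) \<Rightarrow> real \<Rightarrow> real \<Rightarrow> complex \<Rightarrow> bool" where
  "has_HS_integral_on F g a b I \<longleftrightarrow>
     ((\<lambda>D. \<Sum>(x, K)\<in>D. F x * (g (Sup K) - g (Inf K))) \<longlongrightarrow> I) (division_filter (cbox a b))"

definition has_HS_integral :: "(real \<Rightarrow> complex) \<Rightarrow> (real \<Rightarrow> complex) \<Rightarrow> complex \<Rightarrow> bool" where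
  "has_HS_integral F g I \<longleftrightarrow>
     (\<forall>e>0. \<exists>B>0. \<forall>a b. ball 0 B \<subseteq> cbox a b \<longrightarrow>
        (\<exists>z. has_HS_integral_on F g a b z \<and> norm (z - I) < e))"

definition HS_integrable :: "(real \<Rightarrow> complex) \<Rightarrow> (real \<Rightarrow> complex) \<Rightarrow> bool" where
  "HS_integrable F g \<longleftrightarrow> (\<exists>I. has_HS_integral F g I)"

definition HS_integral :: "(real \<Rightarrow> complex) \<Rightarrow> (real \<Rightarrow> complex) \<Rightarrow> complex" where
  "HS_integral F g = (THE I. has_HS_integral F g I)"


section \<open>Fourier transforms\<close>

text \<open>
  The primitive \<open>\<Psi>\<^sub>f\<close> of the Fourier transform of \<open>f\<close>; the latter is the distributional
  derivative \<open>\<Psi>\<^sub>f'\<close>.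
\<close>

definition Fourier_primitive :: "(real \<Rightarrow> complex) \<Rightarrow> real \<Rightarrow> complex" where
  "Fourier_primitive f s =
     (if s = 0 then 0
      else (LINT t|lebesgue. (1 - exp (- \<i> * of_real s * of_real t)) / (\<i> * of_real t) * f t))"

text \<open>
  The continuous primitive integral of the distribution \<open>\<Psi>\<^sub>f'\<close> against \<open>g\<close>, first its domain of
  definition (for \<open>f\<close> in \<^term>\<open>Lvar p\<close>) and then its value.
\<close>

definition Fourier_pairing_defined ::
    "(real \<Rightarrow> ennreal) \<Rightarrow> (real \<Rightarrow> complex) \<Rightarrow> (real \<Rightarrow> complex) \<Rightarrow> bool" where
  "Fourier_pairing_defined p f g \<longleftrightarrow>
     bounded_variation g \<and>
     (\<lambda>x. norm (g x)) \<in> o[at_infinity](\<lambda>x. \<bar>x\<bar> powr (- inv_p_minus p)) \<and>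
     HS_integrable (Fourier_primitive f) g"

definition Fourier_pairing :: "(real \<Rightarrow> complex) \<Rightarrow> (real \<Rightarrow> complex) \<Rightarrow> complex" where
  "Fourier_pairing f g = - HS_integral (Fourier_primitive f) g"

text \<open>
  The Fourier transform of a function of bounded variation vanishing at \<open>\<plusminus>\<infinity>\<close>.  The gauge integral
  over \<^term>\<open>UNIV :: real set\<close> includes improper integrals.  At \<open>t = 0\<close> the integral need not
  exist.
\<close>

definition Fourier_BV :: "(real \<Rightarrow> complex) \<Rightarrow> real \<Rightarrow> complex" where
  "Fourier_BV g t = integral UNIV (\<lambda>s. exp (- \<i> * of_real s * of_real t) * g s)"

text \<open>
  The functions \<open>g\<close> of bounded variation with \<open>g(\<plusminus>\<infinity>) = 0\<close> and
  \<open>\<integral> |s|\<^bsup>1/p\<^sub>-\<^esup> |dg(s)| < \<infinity>\<close>.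
\<close>

definition admissible_BV :: "(real \<Rightarrow> ennreal) \<Rightarrow> (real \<Rightarrow> complex) \<Rightarrow> bool" where
  "admissible_BV p g \<longleftrightarrow>
     bounded_variation g \<and> (g \<longlongrightarrow> 0) at_top \<and> (g \<longlongrightarrow> 0) at_bot \<and>
     (\<integral>\<^sup>+s. ennreal (\<bar>s\<bar> powr inv_p_minus p) \<partial>variation_measure g) < \<infinity>"

end

theory Submission
  imports Defs
begin

text \<open>
  Write \<open>\<kappa>\<^sub>s(t) = (1 - e\<^bsup>-ist\<^esup>) / (it)\<close>, so that \<open>\<Psi>\<^sub>f(s) = \<integral> \<kappa>\<^sub>s(t) f(t) dt\<close>, and note that
  \<open>s \<mapsto> \<kappa>\<^sub>s(t)\<close> is a bounded primitive of \<open>s \<mapsto> e\<^bsup>-ist\<^esup>\<close>.  Formally, integration by parts gives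
  \<open>g\<^sup>^(t) = - \<integral> \<kappa>\<^sub>s(t) dg(s)\<close>, and exchanging the two integrations gives
  \<open>- \<integral> \<Psi>\<^sub>f dg = - \<integral>\<integral> \<kappa>\<^sub>s(t) f(t) dt dg(s) = \<integral> f(t) g\<^sup>^(t) dt\<close>.  Everything is controlled by the
  majorant \<open>h\<^sub>s(t) = min \<bar>s\<bar> (2 / \<bar>t\<bar>)\<close> of \<open>\<bar>\<kappa>\<^sub>s(t)\<bar>\<close>.

  The exchange is made for finite sums, where it is trivial, with an error that is again measured
  by \<open>h\<close>.  On a compact interval let \<open>J(t) = \<integral>\<^sub>a\<^sup>b \<kappa>\<^sub>s(t) dg(s)\<close>, defined through integration by
  parts.  A Stieltjes sum for \<open>J(t)\<close> over a partition of mesh \<open>\<delta>\<close> misses \<open>J(t)\<close> by at most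
  \<open>2 h\<^sub>\<delta>(t)\<close> times the variation of \<open>g\<close> (\<open>kern_stieltjes_approx_kbound\<close>).  Multiplying by
  \<open>f\<close> and integrating, the Stieltjes sums of \<open>\<Psi>\<^sub>f\<close> converge to \<open>\<integral> J f\<close>, because
  \<open>\<integral> h\<^sub>\<delta> \<bar>f\<bar> \<rightarrow> 0\<close> as \<open>\<delta> \<rightarrow> 0\<close>.  Letting the interval grow, \<open>\<bar>J(t) + g\<^sup>^(t)\<bar>\<close> is at most twice
  the integral of \<open>h\<^sub>s(t)\<close> against \<open>\<bar>dg(s)\<bar>\<close> over the complement of the open interval
  (\<open>norm_Fourier_BV_add_le\<close>), and Tonelli's theorem turns this into a bound for
  \<open>\<integral> \<bar>f\<bar> \<bar>J + g\<^sup>^\<bar>\<close>.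

  All that remains is to bound \<open>\<integral> h\<^sub>s \<bar>f\<bar>\<close>.  By Hoelder's inequality this reduces to the norm of
  \<open>h\<^sub>s\<close> in \<open>L\<^bsup>q(\<cdot>)\<^esup>\<close>, and \<open>modular_kbound_le\<close> shows that it is at most a constant times
  \<open>\<bar>s\<bar>\<^bsup>1/r\<^esup>\<close> for \<open>\<bar>s\<bar> \<le> 1\<close> and times \<open>\<bar>s\<bar>\<^bsup>1/p\<^sub>-\<^esup>\<close> for \<open>\<bar>s\<bar> > 1\<close>.  If \<open>p\<^sub>+ < \<infinity>\<close>, then \<open>q\<close> is bounded
  away from \<open>1\<close> and the decay \<open>2 / \<bar>t\<bar>\<close> suffices.  If \<open>1/p\<close> is log-Hoelder continuous at infinity
  with limit \<open>1\<close>, then \<open>q(t)\<close> grows at least like a multiple of \<open>log \<bar>t\<bar>\<close>, so that constants belong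
  to \<open>L\<^bsup>q(\<cdot>)\<^esup>\<close> and the trivial bound \<open>h\<^sub>s \<le> \<bar>s\<bar>\<close> suffices.  Membership of \<open>g\<^sup>^\<close> in \<open>L\<^bsup>q(\<cdot>)\<^esup>\<close> follows
  from the same norm bound by Minkowski's integral inequality.
\<close>

section \<open>The kernel of the primitive of the Fourier transform\<close>

text \<open>
  At \<open>t = 0\<close> division by zero gives the value \<open>0\<close> instead of the limit \<open>s\<close>.  A single \<open>t\<close> is a null
  set, and with the value \<open>0\<close> the bound \<open>norm_kern_le\<close> holds for all \<open>t\<close>, since \<open>2 / \<bar>0\<bar> = 0\<close> as
  well.
\<close>

definition kern :: "real \<Rightarrow> real \<Rightarrow> complex" where
  "kern s t = (1 - exp (- \<i> * of_real s * of_real t)) / (\<i> * of_real t)"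

definition kbound :: "real \<Rightarrow> real \<Rightarrow> real" where
  "kbound s t = min \<bar>s\<bar> (2 / \<bar>t\<bar>)"

lemma kbound_nonneg [simp]: "0 \<le> kbound s t"
  by (simp add: kbound_def)

lemma measurable_kern [measurable]: "kern s \<in> borel_measurable borel"
  unfolding kern_def[abs_def] by measurable

lemma measurable_kbound [measurable]:
  "kbound s \<in> borel_measurable borel" "(\<lambda>s. kbound s t) \<in> borel_measurable borel"
  unfolding kbound_def[abs_def] by measurable

lemma norm_exp_kern [simp]: "norm (exp (- \<i> * of_real s * of_real t)) = 1"
  using norm_exp_i_times[of "-(s*t)"] by (simp add: mult.assoc)

lemma norm_kern_le: "norm (kern s t) \<le> kbound s t"
proof (cases "t = 0")
  case False
  have "norm (exp (\<i> * of_real (-(s*t))) - 1) \<le> \<bar>s\<bar> * \<bar>t\<bar>"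
    unfolding dist_exp_i_1 using abs_sin_x_le_abs_x[of "-(s*t)/2"] by (simp add: abs_mult)
  then have 1: "norm (1 - exp (- \<i> * of_real s * of_real t)) \<le> \<bar>s\<bar> * \<bar>t\<bar>"
    by (simp add: norm_minus_commute mult.assoc)
  have 2: "norm (1 - exp (- \<i> * of_real s * of_real t)) \<le> 2"
    using norm_triangle_ineq4[of 1 "exp (- \<i> * of_real s * of_real t)"] by (simp del: exp_minus)
  from 1 2 False show ?thesis
    by (simp add: kern_def kbound_def norm_divide norm_mult divide_simps)
qed (simp add: kern_def kbound_def)

lemma kern_has_vector_derivative:
  assumes "t \<noteq> 0"
  shows "((\<lambda>s. kern s t) has_vector_derivative exp (- \<i> * of_real s * of_real t)) (at s within S)"
  unfolding kern_def
  by (rule has_vector_derivative_real_field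
        [where f = "\<lambda>s. (1 - exp (- \<i> * s * of_real t)) / (\<i> * of_real t)"])
    (use assms in \<open>auto intro!: derivative_eq_intros\<close>)

lemma kern_has_integral:
  assumes "t \<noteq> 0" "u \<le> v"
  shows "((\<lambda>s. exp (- \<i> * of_real s * of_real t)) has_integral (kern v t - kern u t)) {u..v}"
  using kern_has_vector_derivative[OF assms(1)] assms(2)
  by (intro fundamental_theorem_of_calculus) auto

section \<open>The total variation measure\<close>

lemma partition_sum_le_variation:
  assumes "mono x" "range x \<subseteq> S"
  shows "(\<Sum>i<n. ennreal (norm (g (x (Suc i)) - g (x i)))) \<le> variation g S"
  unfolding variation_def using assms
  by (intro SUP_upper2[where i = "(n, x)"]) auto

text \<open>
  A partition of \<open>{..u}\<close> is continued by the two points \<open>u\<close> and \<open>v\<close>.  The point \<open>u\<close> has to be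
  inserted because the last point of the partition may lie to the left of it.
\<close>

lemma variation_Iic_add:
  assumes "u \<le> v"
  shows "variation g {..u} + ennreal (norm (g v - g u)) \<le> variation g {..v}"
proof -
  have *: "(\<Sum>i<n. ennreal (norm (g (x (Suc i)) - g (x i)))) + ennreal (norm (g v - g u))
      \<le> variation g {..v}" if x: "mono x" "range x \<subseteq> {..u}" for n and x :: "nat \<Rightarrow> real"
  proof -
    define y where "y i = (if i \<le> n then x i else if i = Suc n then u else v)" for i
    have le: "x i \<le> u" for i using x(2) by auto
    have "mono y"
      unfolding y_def incseq_Suc_iff using le assms monoD[OF x(1)] by (auto simp: not_le)
    moreover have "range y \<subseteq> {..v}"
      using le assms unfolding y_def by (force intro: order_trans)
    ultimately have "(\<Sum>i<Suc (Suc n). ennreal (norm (g (y (Suc i)) - g (y i)))) \<le> variation g {..v}"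
      by (rule partition_sum_le_variation)
    moreover have "(\<Sum>i<n. ennreal (norm (g (y (Suc i)) - g (y i)))) =
        (\<Sum>i<n. ennreal (norm (g (x (Suc i)) - g (x i))))"
      by (intro sum.cong) (auto simp: y_def)
    ultimately have "(\<Sum>i<n. ennreal (norm (g (x (Suc i)) - g (x i)))) + ennreal (norm (g u - g (x n)))
        + ennreal (norm (g v - g u)) \<le> variation g {..v}"
      by (simp add: y_def)
    then show ?thesis
      by (rule order_trans[rotated]) (intro add_right_mono, simp)
  qed
  have "variation g {..u} + ennreal (norm (g v - g u)) =
      (SUP (n, x) \<in> {(n :: nat, x :: nat \<Rightarrow> real). mono x \<and> range x \<subseteq> {..u}}.
        (\<Sum>i<n. ennreal (norm (g (x (Suc i)) - g (x i)))) + ennreal (norm (g v - g u)))"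
    unfolding variation_def
    by (subst ennreal_SUP_add_left[symmetric])
      (auto simp: case_prod_beta' intro!: exI[of _ "\<lambda>_. u"] simp: mono_def)
  also have "\<dots> \<le> variation g {..v}"
    using * by (intro SUP_least) (auto simp del: sum_ennreal)
  finally show ?thesis .
qed

lemma variation_mono: "S \<subseteq> T \<Longrightarrow> variation g S \<le> variation g T"
  unfolding variation_def by (intro SUP_subset_mono) auto

lemma increment_le_variation_function:
  assumes "bounded_variation g" "u \<le> v"
  shows "norm (g v - g u) \<le> variation_function g v - variation_function g u"
proof -
  have fin: "variation g {..x} < \<infinity>" for x
    using assms(1) variation_mono[of "{..x}" UNIV g] unfolding bounded_variation_def
    by (auto intro: le_less_trans)
  obtain a b where ab: "variation g {..u} = ennreal a" "variation g {..v} = ennreal b" "0 \<le> a" "0 \<le> b"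
    using fin[of u] fin[of v]  by (cases "variation g {..u}"; cases "variation g {..v}") auto
  have "ennreal (a + norm (g v - g u)) \<le> ennreal b"
    using variation_Iic_add[OF assms(2), of g] ab by simp
  then have "a + norm (g v - g u) \<le> b"
    using ab(4) by (simp only: ennreal_le_iff)
  then show ?thesis
    using ab unfolding variation_function_def by simp
qed

lemma variation_function_bounds:
  assumes "bounded_variation g"
  shows "0 \<le> variation_function g x" "variation_function g x \<le> enn2real (variation g UNIV)"
proof -
  show "variation_function g x \<le> enn2real (variation g UNIV)"
    using assms variation_mono[of "{..x}" UNIV g]
    unfolding bounded_variation_def variation_function_def
    by (intro enn2real_mono) auto
qed (simp add: variation_function_def)

lemma mono_variation_function: "bounded_variation g \<Longrightarrow> mono (variation_function g)"
  by (intro monoI) (smt (verit) increment_le_variation_function norm_ge_zero)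

text \<open>
  Applied to the variation function \<open>V\<close>, this is the function whose interval measure is the variation
  measure; unlike \<open>V\<close> it is right-continuous.
\<close>

definition right_limit :: "(real \<Rightarrow> real) \<Rightarrow> real \<Rightarrow> real" where
  "right_limit V x = Lim (at_right x) V"

lemma mono_tendsto_at_right:
  fixes V :: "real \<Rightarrow> real"
  assumes "mono V"
  shows "(V \<longlongrightarrow> Inf (V ` {x<..})) (at_right x)"
proof (rule order_tendstoI)
  have bdd: "bdd_below (V ` {x<..})"
    by (rule bdd_belowI[of _ "V x"]) (auto intro: monoD[OF assms])
  fix c
  {
    assume c: "c < Inf (V ` {x<..})"
    have "c < V y" if "x < y" for y
      using c cInf_lower[OF _ bdd, of "V y"] that by auto
    then show "\<forall>\<^sub>F y in at_right x. c < V y"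
      by (auto simp: eventually_at_right_field intro: exI[of _ "x + 1"])
  next
    assume "Inf (V ` {x<..}) < c"
    then obtain y where y: "x < y" "V y < c"
      using bdd by (auto simp: cInf_less_iff)
    have "V z < c" if "z < y" for z
      using monoD[OF assms, of z y] y(2) that by auto
    with y(1) show "\<forall>\<^sub>F y in at_right x. V y < c"
      by (auto simp: eventually_at_right_field intro!: exI[of _ y])
  }
qed

lemma right_limit_eq: "mono V \<Longrightarrow> right_limit V x = Inf (V ` {x<..})"
  unfolding right_limit_def by (intro tendsto_Lim mono_tendsto_at_right) auto

lemma right_limit_bounds:
  assumes "mono V"
  shows "V x \<le> right_limit V x" "x < y \<Longrightarrow> right_limit V x \<le> V y"
  unfolding right_limit_eq[OF assms]
  by (intro cInf_greatest cInf_lower bdd_belowI[of _ "V x"]; auto intro: monoD[OF assms])+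

lemma mono_right_limit:
  assumes "mono V" shows "mono (right_limit V)"
  using right_limit_bounds[OF assms] by (intro monoI) (metis order.order_iff_strict order_trans)

lemma continuous_right_limit:
  assumes "mono V"
  shows "continuous (at_right x) (right_limit V)"
  unfolding continuous_within
proof (rule order_tendstoI)
  note b = right_limit_bounds[OF assms]
  fix c
  {
    assume c: "c < right_limit V x"
    have "c < right_limit V y" if "x < y" for y
      using c monoD[OF mono_right_limit[OF assms], of x y] that by auto
    then show "\<forall>\<^sub>F y in at_right x. c < right_limit V y"
      by (auto simp: eventually_at_right_field intro!: exI[of _ "x + 1"])
  next
    assume "right_limit V x < c"
    then have "\<forall>\<^sub>F y in at_right x. V y < c"
      using mono_tendsto_at_right[OF assms, of x] order_tendstoD(2) right_limit_eq[OF assms, of x] by metis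
    then obtain d where d: "x < d" "\<And>y. x < y \<Longrightarrow> y < d \<Longrightarrow> V y < c"
      by (auto simp: eventually_at_right_field)
    have "right_limit V y < c" if "x < y" "y < d" for y
    proof -
      obtain z where "y < z" "z < d" using \<open>y < d\<close> dense by blast
      then show ?thesis using b(2)[of y z] d(2)[of z] that by auto
    qed
    then show "\<forall>\<^sub>F y in at_right x. right_limit V y < c"
      using d(1) by (auto simp: eventually_at_right_field intro: exI[of _ d])
  }
qed

lemma variation_measure_eq:
  "variation_measure g = interval_measure (right_limit (variation_function g))"
  by (simp add: variation_measure_def right_limit_def[abs_def])

lemma sets_variation_measure [simp, measurable_cong]: "sets (variation_measure g) = sets borel"
  and space_variation_measure [simp]: "space (variation_measure g) = UNIV"
  by (simp_all add: variation_measure_def)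

lemma emeasure_variation_measure_Ioc:
  assumes "bounded_variation g" "a \<le> b"
  shows "emeasure (variation_measure g) {a<..b} =
    right_limit (variation_function g) b - right_limit (variation_function g) a"
  unfolding variation_measure_eq
  using mono_right_limit[OF mono_variation_function[OF assms(1)]]
    continuous_right_limit[OF mono_variation_function[OF assms(1)]] assms(2)
  by (intro emeasure_interval_measure_Ioc) (auto dest: monoD)

lemma finite_variation_measure:
  assumes "bounded_variation g"
  shows "finite_measure (variation_measure g)"
proof
  let ?U = "right_limit (variation_function g)" and ?V = "variation_function g"
  let ?T = "enn2real (variation g UNIV)"
  note m = mono_variation_function[OF assms]
  have U: "0 \<le> ?U x" "?U x \<le> ?T" for x
    using right_limit_bounds[OF m, of x] variation_function_bounds[OF assms, of x]
      right_limit_bounds(2)[OF m, of x "x + 1"] variation_function_bounds[OF assms, of "x + 1"]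
    by linarith+
  have "emeasure (variation_measure g) (\<Union>n::nat. {- real n<..real n}) =
      (SUP n::nat. emeasure (variation_measure g) {- real n<..real n})"
    by (intro SUP_emeasure_incseq[symmetric]) (auto simp: incseq_def)
  also have "\<dots> \<le> ennreal ?T"
  proof (rule SUP_least)
    fix n
    show "emeasure (variation_measure g) {- real n<..real n} \<le> ennreal ?T"
      using U(1)[of "- real n"] U(2)[of "real n"]
      by (simp add: emeasure_variation_measure_Ioc[OF assms] ennreal_leI)
  qed
  also have "(\<Union>n::nat. {- real n<..real n}) = UNIV"
  proof (intro set_eqI iffI UNIV_I)
    fix x :: real
    obtain n where "\<bar>x\<bar> < real n" using reals_Archimedean2 by blast
    then show "x \<in> (\<Union>n::nat. {- real n<..real n})" by (auto intro!: exI[of _ n])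
  qed
  finally show "emeasure (variation_measure g) (space (variation_measure g)) \<noteq> \<infinity>"
    by (auto simp: top_unique)
qed

text \<open>
  The closed interval is needed, because \<open>V(b) - V(a)\<close> may contain part of the jumps of \<open>V\<close> at
  both ends: \<open>V(b) - V(a) \<le> V(b+) - V(a-)\<close>.  Only right limits are at hand, so the left end is
  approached by the half-open intervals from \<open>a - 1 / n\<close>.
\<close>

lemma variation_function_diff_le_measure:
  assumes "bounded_variation g" "a \<le> b"
  shows "variation_function g b - variation_function g a \<le> measure (variation_measure g) {a..b}"
proof -
  let ?U = "right_limit (variation_function g)" and ?V = "variation_function g"
  interpret finite_measure "variation_measure g" by (rule finite_variation_measure) fact
  note m = mono_variation_function[OF assms(1)]
  have "(\<lambda>n. measure (variation_measure g) {a - 1 / real (Suc n)<..b})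
      \<longlonglongrightarrow> measure (variation_measure g) (\<Inter>n. {a - 1 / real (Suc n)<..b})"
  proof (rule finite_Lim_measure_decseq)
    show "decseq (\<lambda>n. {a - 1 / real (Suc n)<..b})"
    proof (rule decseq_SucI)
      fix n
      have "1 / real (Suc (Suc n)) \<le> 1 / real (Suc n)" by (intro divide_left_mono) auto
      then show "{a - 1 / real (Suc (Suc n))<..b} \<subseteq> {a - 1 / real (Suc n)<..b}" by auto
    qed
  qed auto
  also have "(\<Inter>n. {a - 1 / real (Suc n)<..b}) = {a..b}"
  proof (intro set_eqI iffI)
    fix x assume x: "x \<in> (\<Inter>n. {a - 1 / real (Suc n)<..b})"
    have "(\<lambda>n. a - 1 / real (Suc n)) \<longlonglongrightarrow> a - 0"
      by (intro tendsto_intros LIMSEQ_Suc lim_1_over_n)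
    then have "a \<le> x"
      using x by (intro LIMSEQ_le_const2[where X = "\<lambda>n. a - 1 / real (Suc n)"]) (auto intro: less_imp_le)
    with x show "x \<in> {a..b}" by auto
  next
    fix x assume x: "x \<in> {a..b}"
    have "a - 1 / real (Suc n) < a" for n by simp
    from less_le_trans[OF this] x show "x \<in> (\<Inter>n. {a - 1 / real (Suc n)<..b})"
      by (auto simp del: of_nat_Suc)
  qed
  finally show ?thesis
  proof (rule LIMSEQ_le_const, intro exI[of _ 0] allI impI)
    fix n
    have lt: "a - 1 / real (Suc n) < a" by simp
    have "?U (a - 1 / real (Suc n)) \<le> ?V a" "?V b \<le> ?U b"
      by (rule right_limit_bounds(2)[OF m lt], rule right_limit_bounds(1)[OF m])
    then have "?V b - ?V a \<le> ?U b - ?U (a - 1 / real (Suc n))" by linarith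
    also have "\<dots> = measure (variation_measure g) {a - 1 / real (Suc n)<..b}"
    proof -
      have le: "a - 1 / real (Suc n) \<le> b" using lt assms(2) by linarith
      show ?thesis
        unfolding measure_def emeasure_variation_measure_Ioc[OF assms(1) le]
        using monoD[OF mono_right_limit[OF m] le] by simp
    qed
    finally show "?V b - ?V a \<le> measure (variation_measure g) {a - 1 / real (Suc n)<..b}" .
  qed
qed

text \<open>
  The real and imaginary parts of \<open>g\<close> are differences of the increasing functions \<open>V\<close> and
  \<open>V - Re g\<close>, respectively \<open>V - Im g\<close>.
\<close>

lemma borel_measurable_bounded_variation:
  assumes "bounded_variation g"
  shows "g \<in> borel_measurable borel"
proof -
  let ?V = "variation_function g"
  have "(\<lambda>x. L (g x)) \<in> borel_measurable borel"
    if L: "\<And>a b. L a - L b \<le> norm (a - b)" for L :: "complex \<Rightarrow> real"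
  proof -
    have "mono (\<lambda>x. ?V x - L (g x))"
    proof (rule monoI)
      fix x y :: real assume "x \<le> y"
      then show "?V x - L (g x) \<le> ?V y - L (g y)"
        using increment_le_variation_function[OF assms, of x y] L[of "g y" "g x"] by linarith
    qed
    then have "(\<lambda>x. ?V x - (?V x - L (g x))) \<in> borel_measurable borel"
      by (intro borel_measurable_diff borel_measurable_mono mono_variation_function[OF assms])
    then show ?thesis by simp
  qed
  from this[of Re] this[of Im] show ?thesis
    using complex_Re_le_cmod[of "_ - _"] abs_Im_le_cmod[of "_ - _"]
    by (auto simp: borel_measurable_complex_iff abs_le_iff)
qed

section \<open>Stieltjes integrals of the kernel\<close>

text \<open>
  Subdividing \<open>[a, b]\<close> into \<open>n\<close> equal parts makes the contribution of the terms \<open>(v - u) N u v\<close>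
  at most \<open>(b - a) N' / n\<close>.  Thus estimates of an additive interval function on small
  intervals need to hold only up to an error of this form.
\<close>

lemma norm_le_of_partition_sums:
  fixes J :: "real \<Rightarrow> real \<Rightarrow> complex" and A N :: "real \<Rightarrow> real \<Rightarrow> real"
  assumes ab: "a \<le> b"
    and add: "\<And>u v w. a \<le> u \<Longrightarrow> u \<le> v \<Longrightarrow> v \<le> w \<Longrightarrow> w \<le> b \<Longrightarrow> J u w = J u v + J v w"
    and bound: "\<And>u v. a \<le> u \<Longrightarrow> u \<le> v \<Longrightarrow> v \<le> b \<Longrightarrow> norm (J u v) \<le> A u v + (v - u) * N u v"
    and A: "\<And>n x. strict_mono x \<Longrightarrow> x 0 = a \<Longrightarrow> x n = b \<Longrightarrow> (\<Sum>i<n. A (x i) (x (Suc i))) \<le> A'"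
    and N: "\<And>n x. strict_mono x \<Longrightarrow> x 0 = a \<Longrightarrow> x n = b \<Longrightarrow> (\<Sum>i<n. N (x i) (x (Suc i))) \<le> N'"
  shows "norm (J a b) \<le> A'"
proof (cases "a = b")
  case True
  have "J b b = J b b + J b b" using add[of b b b] True by simp
  then show ?thesis
    using A[of "\<lambda>i. a + real i" 0] True by (simp add: strict_mono_def)
next
  case False
  with ab have lt: "a < b" by simp
  have le: "norm (J a b) \<le> A' + (b - a) / real (Suc n) * N'" for n
  proof -
    define x where "x i = a + real i * ((b - a) / real (Suc n))" for i
    have x: "strict_mono x" "x 0 = a" "x (Suc n) = b"
      using lt by (auto simp: x_def strict_mono_def divide_strict_right_mono)
    note mono = strict_mono_leD[OF x(1)]
    have step: "x (Suc i) - x i = (b - a) / real (Suc n)" for i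
      unfolding x_def of_nat_Suc[of i] distrib_right by simp
    have "J a (x k) = (\<Sum>i<k. J (x i) (x (Suc i)))" if "k \<le> Suc n" for k
      using that
    proof (induction k)
      case 0
      have "J a a = J a a + J a a" using lt by (intro add) auto
      then show ?case by (simp add: x)
    next
      case (Suc k)
      have "J a (x (Suc k)) = J a (x k) + J (x k) (x (Suc k))"
        using mono[of 0 k] mono[of k "Suc k"] mono[of "Suc k" "Suc n"] Suc.prems x by (intro add) auto
      with Suc show ?case by simp
    qed
    from this[of "Suc n"] have "norm (J a b) = norm (\<Sum>i<Suc n. J (x i) (x (Suc i)))"
      by (simp only: x)
    also have "\<dots> \<le> (\<Sum>i<Suc n. norm (J (x i) (x (Suc i))))"
      by (rule norm_sum)
    also have "\<dots> \<le> (\<Sum>i<Suc n. A (x i) (x (Suc i)) + (x (Suc i) - x i) * N (x i) (x (Suc i)))"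
    proof (rule sum_mono)
      fix i assume i: "i \<in> {..<Suc n}"
      show "norm (J (x i) (x (Suc i))) \<le> A (x i) (x (Suc i)) + (x (Suc i) - x i) * N (x i) (x (Suc i))"
        using mono[of 0 i] mono[of i "Suc i"] mono[of "Suc i" "Suc n"] i x by (intro bound) auto
    qed
    also have "\<dots> = (\<Sum>i<Suc n. A (x i) (x (Suc i))) + (b - a) / real (Suc n) * (\<Sum>i<Suc n. N (x i) (x (Suc i)))"
      unfolding step sum.distrib sum_distrib_left ..
    also have "\<dots> \<le> A' + (b - a) / real (Suc n) * N'"
      using lt by (intro add_mono mult_left_mono A N x) auto
    finally show ?thesis .
  qed
  have "(\<lambda>n. A' + (b - a) * (1 / real (Suc n)) * N') \<longlonglongrightarrow> A' + (b - a) * 0 * N'"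
    by (intro tendsto_intros LIMSEQ_Suc lim_1_over_n)
  with le show ?thesis
    by (intro LIMSEQ_le_const[where X = "\<lambda>n. A' + (b - a) * (1 / real (Suc n)) * N'"]) auto
qed

text \<open>
  Neighbouring intervals of a partition share their end point, which may be an atom of the variation
  measure.  Hence the factor \<open>2\<close> here and in the estimates derived from it.
\<close>

lemma sum_indicator_Icc_le:
  fixes x :: "nat \<Rightarrow> real"
  assumes "strict_mono x"
  shows "(\<Sum>i<n. indicator {x i..x (Suc i)} s :: real) \<le> 2 * indicator {x 0..x n} s"
proof -
  \<comment> \<open>The last point is counted only once so far, which leaves room for the next interval.\<close>
  have "(\<Sum>i<n. indicator {x i..x (Suc i)} s :: real) \<le> 2 * indicator {x 0..<x n} s + indicator {x n} s"
  proof (induction n)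
    case (Suc n)
    have "x 0 \<le> x n" "x n < x (Suc n)"
      using strict_mono_leD[OF assms] strict_monoD[OF assms] by auto
    then have "2 * indicator {x 0..<x n} s + indicator {x n} s + indicator {x n..x (Suc n)} s
        \<le> (2 * indicator {x 0..<x (Suc n)} s + indicator {x (Suc n)} s :: real)"
      by (auto simp: indicator_def)
    with Suc show ?case by simp
  qed simp
  also have "\<dots> \<le> 2 * indicator {x 0..x n} s"
    using strict_mono_leD[OF assms, of 0 n] by (auto simp: indicator_def)
  finally show ?thesis .
qed

text \<open>
  The Riemann--Stieltjes integral of \<open>s \<mapsto> \<kappa>\<^sub>s(t)\<close> with respect to \<open>g\<close> over \<open>[u, v]\<close>, written by
  means of integration by parts, so that it is meaningful before any convergence of Stieltjes sums
  is known.
\<close>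

definition kern_stieltjes :: "(real \<Rightarrow> complex) \<Rightarrow> real \<Rightarrow> real \<Rightarrow> real \<Rightarrow> complex" where
  "kern_stieltjes g t u v =
     kern v t * g v - kern u t * g u - integral {u..v} (\<lambda>s. exp (- \<i> * of_real s * of_real t) * g s)"

lemma norm_le_of_bounded_variation:
  assumes "bounded_variation g"
  shows "norm (g x) \<le> norm (g 0) + enn2real (variation g UNIV)"
proof -
  have "norm (g x - g 0) \<le> enn2real (variation g UNIV)"
    using increment_le_variation_function[OF assms, of 0 x] increment_le_variation_function[OF assms, of x 0]
      variation_function_bounds[OF assms, of 0] variation_function_bounds[OF assms, of x]
    by (cases "0 \<le> x") (auto simp: norm_minus_commute)
  then show ?thesis using norm_triangle_sub[of "g x" "g 0"] by linarith
qed

lemma set_integrable_exp_mult: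
  assumes "bounded_variation g"
  shows "set_integrable lborel {u..v} (\<lambda>s. exp (- \<i> * of_real s * of_real t) * g s)"
  unfolding set_integrable_def
proof (rule integrableI_bounded_set_indicator)
  show "(\<lambda>s. exp (- \<i> * of_real s * of_real t) * g s) \<in> borel_measurable lborel"
    using borel_measurable_bounded_variation[OF assms] by measurable
  show "AE s in lborel. s \<in> {u..v} \<longrightarrow> norm (exp (- \<i> * of_real s * of_real t) * g s)
      \<le> norm (g 0) + enn2real (variation g UNIV)"
    unfolding norm_mult norm_exp_kern using norm_le_of_bounded_variation[OF assms] by simp
qed (auto simp: emeasure_lborel_Icc_eq)

lemma integrable_on_exp_mult:
  assumes "bounded_variation g"
  shows "(\<lambda>s. exp (- \<i> * of_real s * of_real t) * g s) integrable_on {u..v}"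
  using set_borel_integral_eq_integral(1)[OF set_integrable_exp_mult[OF assms]] .

lemma measurable_kern_stieltjes [measurable]:
  assumes "bounded_variation g"
  shows "(\<lambda>t. kern_stieltjes g t u v) \<in> borel_measurable borel"
proof -
  note [measurable] = borel_measurable_bounded_variation[OF assms]
  have "integral {u..v} (\<lambda>s. exp (- \<i> * of_real s * of_real t) * g s) =
      (LINT s|lborel. indicator {u..v} s *\<^sub>R (exp (- \<i> * of_real s * of_real t) * g s))" for t
    using set_borel_integral_eq_integral(2)[OF set_integrable_exp_mult[OF assms], of u v t]
    by (simp add: set_lebesgue_integral_def)
  then show ?thesis
    unfolding kern_stieltjes_def[abs_def] by simp
qed

context
  fixes g :: "real \<Rightarrow> complex" and t :: real
  assumes bv: "bounded_variation g" and t: "t \<noteq> 0"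
begin

lemma kern_stieltjes_combine:
  assumes "u \<le> v" "v \<le> w"
  shows "kern_stieltjes g t u w = kern_stieltjes g t u v + kern_stieltjes g t v w"
  using Henstock_Kurzweil_Integration.integral_combine[OF assms integrable_on_exp_mult[OF bv, of t]]
  by (simp add: kern_stieltjes_def algebra_simps)

text \<open>
  The difference is the integral of \<open>e\<^bsup>-ist\<^esup> (g(v) - g(s))\<close> over \<open>[x, v]\<close> plus the integral of
  \<open>e\<^bsup>-ist\<^esup> (g(u) - g(s))\<close> over \<open>[u, x]\<close>, and the increments of \<open>g\<close> are at most the increment of its
  variation function over \<open>[u, v]\<close>.
\<close>

lemma kern_stieltjes_approx:
  assumes "u \<le> x" "x \<le> v"
  shows "norm (kern_stieltjes g t u v - kern x t * (g v - g u))
    \<le> (v - u) * (variation_function g v - variation_function g u)"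
proof -
  let ?e = "\<lambda>s. exp (- \<i> * of_real s * of_real t)"
  let ?D = "variation_function g v - variation_function g u"
  note V = increment_le_variation_function[OF bv] and mono = monoD[OF mono_variation_function[OF bv]]
  have int: "((\<lambda>s. ?e s * (c - g s)) has_integral
      ((kern b t - kern a t) * c - integral {a..b} (\<lambda>s. ?e s * g s))) {a..b}" if "a \<le> b" for a b c
    unfolding right_diff_distrib
    by (intro has_integral_diff has_integral_mult_left kern_has_integral t that
        integrable_integral integrable_on_exp_mult bv)
  have 1: "norm ((kern v t - kern x t) * g v - integral {x..v} (\<lambda>s. ?e s * g s)) \<le> ?D * (v - x)"
  proof -
    have "norm (?e s * (g v - g s)) \<le> ?D" if "s \<in> {x..v}" for s
      unfolding norm_mult norm_exp_kern using V[of s v] mono[of u s] assms that by simp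
    then show ?thesis
      using has_integral_bound_real[OF _ finite.emptyI int[OF assms(2)], of ?D "g v"] mono[of u v] assms by auto
  qed
  have 2: "norm ((kern x t - kern u t) * g u - integral {u..x} (\<lambda>s. ?e s * g s)) \<le> ?D * (x - u)"
  proof -
    have "norm (?e s * (g u - g s)) \<le> ?D" if "s \<in> {u..x}" for s
      unfolding norm_mult norm_exp_kern using V[of u s] mono[of s v] assms that
      by (simp add: norm_minus_commute)
    then show ?thesis
      using has_integral_bound_real[OF _ finite.emptyI int[OF assms(1)], of ?D "g u"] mono[of u v] assms by auto
  qed
  have "kern_stieltjes g t u v - kern x t * (g v - g u) =
      ((kern v t - kern x t) * g v - integral {x..v} (\<lambda>s. ?e s * g s)) +
      ((kern x t - kern u t) * g u - integral {u..x} (\<lambda>s. ?e s * g s))"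
    using Henstock_Kurzweil_Integration.integral_combine[OF assms integrable_on_exp_mult[OF bv, of t]]
    by (simp add: kern_stieltjes_def algebra_simps)
  then have "norm (kern_stieltjes g t u v - kern x t * (g v - g u)) \<le> ?D * (v - x) + ?D * (x - u)"
    using norm_triangle_mono[OF 1 2] by simp
  then show ?thesis by (simp add: algebra_simps)
qed

lemma kern_stieltjes_le_variation:
  assumes "a \<le> b"
  shows "norm (kern_stieltjes g t a b) \<le> 2 / \<bar>t\<bar> * (variation_function g b - variation_function g a)"
proof (rule norm_le_of_partition_sums[OF assms, where J = "kern_stieltjes g t"
      and N = "\<lambda>u v. variation_function g v - variation_function g u"
      and A = "\<lambda>u v. 2 / \<bar>t\<bar> * (variation_function g v - variation_function g u)"])
  let ?V = "variation_function g"
  have tel: "(\<Sum>i<n. ?V (x (Suc i)) - ?V (x i)) = ?V (x n) - ?V (x 0)" for n x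
    by (rule sum_lessThan_telescope)
  show "(\<Sum>i<n. ?V (x (Suc i)) - ?V (x i)) \<le> ?V b - ?V a"
    "(\<Sum>i<n. 2 / \<bar>t\<bar> * (?V (x (Suc i)) - ?V (x i))) \<le> 2 / \<bar>t\<bar> * (?V b - ?V a)"
    if "x 0 = a" "x n = b" for n and x :: "nat \<Rightarrow> real"
    unfolding sum_distrib_left[symmetric] tel that by simp_all
  fix u v :: real assume uv: "u \<le> v"
  have "norm (kern u t) \<le> 2 / \<bar>t\<bar>"
    using norm_kern_le[of u t] by (simp add: kbound_def)
  then have "norm (kern u t * (g v - g u)) \<le> 2 / \<bar>t\<bar> * (?V v - ?V u)"
    unfolding norm_mult using increment_le_variation_function[OF bv uv] by (intro mult_mono) auto
  then show "norm (kern_stieltjes g t u v) \<le> 2 / \<bar>t\<bar> * (?V v - ?V u) + (v - u) * (?V v - ?V u)"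
    using kern_stieltjes_approx[of u u v] uv
      norm_triangle_sub[of "kern_stieltjes g t u v" "kern u t * (g v - g u)"] by linarith
qed (rule kern_stieltjes_combine)

text \<open>
  Up to a factor this is the minimum of two bounds: \<open>d\<close> times the variation by
  \<open>kern_stieltjes_approx\<close>, and \<open>4 / \<bar>t\<bar>\<close> times the variation, because both the integral and its
  approximation are at most \<open>2 / \<bar>t\<bar>\<close> times the variation.  The second bound makes the error small
  in \<open>L\<^bsup>q(\<cdot>)\<^esup>\<close> and not only pointwise.
\<close>

lemma kern_stieltjes_approx_kbound:
  assumes "u \<le> x" "x \<le> v" "v - u \<le> d"
  shows "norm (kern_stieltjes g t u v - kern x t * (g v - g u))
    \<le> 2 * kbound d t * (variation_function g v - variation_function g u)"
proof -
  let ?D = "variation_function g v - variation_function g u"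
  have uv: "u \<le> v" using assms by simp
  have D: "0 \<le> ?D" using monoD[OF mono_variation_function[OF bv] uv] by simp
  have "norm (kern x t) \<le> 2 / \<bar>t\<bar>"
    using norm_kern_le[of x t] by (simp add: kbound_def)
  then have "norm (kern x t * (g v - g u)) \<le> 2 / \<bar>t\<bar> * ?D"
    unfolding norm_mult using increment_le_variation_function[OF bv uv] by (intro mult_mono) auto
  with kern_stieltjes_le_variation[OF uv]
  have 1: "norm (kern_stieltjes g t u v - kern x t * (g v - g u)) \<le> 2 * (2 / \<bar>t\<bar>) * ?D"
    using norm_triangle_ineq4[of "kern_stieltjes g t u v" "kern x t * (g v - g u)"] by linarith
  have "(v - u) * ?D \<le> 2 * \<bar>d\<bar> * ?D"
    using D assms by (intro mult_right_mono) auto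
  with kern_stieltjes_approx[OF assms(1,2)]
  have 2: "norm (kern_stieltjes g t u v - kern x t * (g v - g u)) \<le> 2 * \<bar>d\<bar> * ?D" by linarith
  from 1 2 show ?thesis by (auto simp: kbound_def min_def)
qed

text \<open>
  On a short interval \<open>[u, v]\<close> the integral is close to \<open>\<kappa>\<^sub>u(t) (g(v) - g(u))\<close>, whose modulus is at
  most \<open>h\<^sub>u(t)\<close> times the mass of \<open>[u, v]\<close>, and \<open>h\<^sub>u(t) \<le> h\<^sub>s(t) + (v - u)\<close> for \<open>s\<close> in \<open>[u, v]\<close>.
\<close>

lemma kern_stieltjes_le_integral:
  assumes "a \<le> b"
  shows "ennreal (norm (kern_stieltjes g t a b))
    \<le> 2 * (\<integral>\<^sup>+s\<in>{a..b}. ennreal (kbound s t) \<partial>variation_measure g)"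
proof -
  let ?\<mu> = "variation_measure g"
  interpret finite_measure ?\<mu> by (rule finite_variation_measure[OF bv])
  have int: "integrable ?\<mu> (\<lambda>s. indicator {u..v} s * kbound s t)" for u v
    by (rule integrable_const_bound[of _ "2 / \<bar>t\<bar>"])
      (auto simp: kbound_def indicator_def intro!: AE_I2)
  have ind: "integrable ?\<mu> (indicat_real {u..v})" for u v
    by (rule integrable_const_bound[of _ 1]) auto
  have "norm (kern_stieltjes g t a b) \<le> 2 * (\<integral>s. indicator {a..b} s * kbound s t \<partial>?\<mu>)"
  proof (rule norm_le_of_partition_sums[OF assms, where J = "kern_stieltjes g t"
      and N = "\<lambda>u v. 2 * measure ?\<mu> {u..v}"
      and A = "\<lambda>u v. (\<integral>s. indicator {u..v} s * kbound s t \<partial>?\<mu>)"])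
    fix n and x :: "nat \<Rightarrow> real" assume x: "strict_mono x" "x 0 = a" "x n = b"
    have "(\<Sum>i<n. \<integral>s. indicator {x i..x (Suc i)} s * kbound s t \<partial>?\<mu>) =
        (\<integral>s. (\<Sum>i<n. indicator {x i..x (Suc i)} s * kbound s t) \<partial>?\<mu>)"
      by (intro Bochner_Integration.integral_sum[symmetric] int)
    also have "\<dots> \<le> (\<integral>s. 2 * (indicator {a..b} s * kbound s t) \<partial>?\<mu>)"
      using sum_indicator_Icc_le[OF x(1), where n = n]
      by (intro integral_mono Bochner_Integration.integrable_sum integrable_mult_right int)
        (auto simp: sum_distrib_right[symmetric] mult.assoc[symmetric] x intro!: mult_right_mono)
    finally show "(\<Sum>i<n. \<integral>s. indicator {x i..x (Suc i)} s * kbound s t \<partial>?\<mu>) \<le>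
        2 * (\<integral>s. indicator {a..b} s * kbound s t \<partial>?\<mu>)" by simp
    have "(\<Sum>i<n. measure ?\<mu> {x i..x (Suc i)}) = (\<integral>s. (\<Sum>i<n. indicator {x i..x (Suc i)} s) \<partial>?\<mu>)"
      by (subst Bochner_Integration.integral_sum) (auto intro: ind)
    also have "\<dots> \<le> (\<integral>s. 2 * indicator {a..b} s \<partial>?\<mu>)"
      using sum_indicator_Icc_le[OF x(1), where n = n]
      by (intro integral_mono Bochner_Integration.integrable_sum integrable_mult_right ind) (auto simp: x)
    finally show "(\<Sum>i<n. 2 * measure ?\<mu> {x i..x (Suc i)}) \<le> 4 * measure ?\<mu> {a..b}"
      by (simp add: sum_distrib_left[symmetric])
  next
    fix u v :: real assume uv: "u \<le> v"
    let ?D = "variation_function g v - variation_function g u"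
    have D: "0 \<le> ?D" "?D \<le> measure ?\<mu> {u..v}"
      using monoD[OF mono_variation_function[OF bv] uv] variation_function_diff_le_measure[OF bv uv] by auto
    have "norm (kern u t * (g v - g u)) \<le> kbound u t * ?D"
      unfolding norm_mult using increment_le_variation_function[OF bv uv] norm_kern_le
      by (intro mult_mono) auto
    then have "norm (kern_stieltjes g t u v) \<le> (kbound u t + (v - u)) * ?D"
      using kern_stieltjes_approx[of u u v] uv
        norm_triangle_sub[of "kern_stieltjes g t u v" "kern u t * (g v - g u)"]
      by (simp add: algebra_simps)
    also have "\<dots> \<le> (kbound u t + (v - u)) * measure ?\<mu> {u..v}"
      using D uv by (intro mult_left_mono) auto
    finally have 1: "norm (kern_stieltjes g t u v) \<le>
        kbound u t * measure ?\<mu> {u..v} + (v - u) * measure ?\<mu> {u..v}"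
      by (simp add: algebra_simps)
    have "kbound u t * measure ?\<mu> {u..v} = (\<integral>s. indicator {u..v} s * kbound u t \<partial>?\<mu>)"
      by simp
    also have "\<dots> \<le> (\<integral>s. indicator {u..v} s * kbound s t + indicator {u..v} s * (v - u) \<partial>?\<mu>)"
    proof (rule integral_mono)
      show "indicator {u..v} s * kbound u t \<le> indicator {u..v} s * kbound s t + indicator {u..v} s * (v - u)"
        for s by (auto simp: kbound_def indicator_def min_def)
    qed (intro Bochner_Integration.integrable_add int integrable_mult_left ind)+
    also have "\<dots> = (\<integral>s. indicator {u..v} s * kbound s t \<partial>?\<mu>) + (v - u) * measure ?\<mu> {u..v}"
      by (subst Bochner_Integration.integral_add[OF int]) (auto intro: ind)
    finally show "norm (kern_stieltjes g t u v)
        \<le> (\<integral>s. indicator {u..v} s * kbound s t \<partial>?\<mu>) + (v - u) * (2 * measure ?\<mu> {u..v})"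
      using 1 by simp
  qed (rule kern_stieltjes_combine)
  then have "ennreal (norm (kern_stieltjes g t a b)) \<le>
     ennreal (2 * (\<integral>s. indicator {a..b} s * kbound s t \<partial>?\<mu>))"
    by (rule ennreal_leI)
  also have "\<dots> = 2 * ennreal (\<integral>s. indicator {a..b} s * kbound s t \<partial>?\<mu>)"
    by (simp add: ennreal_mult')
  also have "ennreal (\<integral>s. indicator {a..b} s * kbound s t \<partial>?\<mu>) =
      (\<integral>\<^sup>+s. ennreal (indicator {a..b} s * kbound s t) \<partial>?\<mu>)"
    by (intro nn_integral_eq_integral[symmetric] int) auto
  also have "(\<integral>\<^sup>+s. ennreal (indicator {a..b} s * kbound s t) \<partial>?\<mu>) =
      (\<integral>\<^sup>+s\<in>{a..b}. ennreal (kbound s t) \<partial>?\<mu>)"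
    by (intro nn_integral_cong) (auto simp: indicator_def)
  finally show ?thesis .
qed

end

section \<open>The Fourier transform of a function of bounded variation\<close>

lemma finite_measure_tail_small:
  fixes N :: "real measure"
  assumes "finite_measure N" and sets: "sets N = sets borel" and "0 < e"
  obtains B where "0 < B" "measure N {s. B \<le> \<bar>s\<bar>} < e"
proof -
  interpret finite_measure N by fact
  have [measurable_cong]: "sets N = sets borel" by fact
  have "(\<lambda>n. measure N {s. real (Suc n) \<le> \<bar>s\<bar>}) \<longlonglongrightarrow> measure N (\<Inter>n. {s. real (Suc n) \<le> \<bar>s\<bar>})"
    by (rule finite_Lim_measure_decseq) (auto simp: decseq_def sets)
  also have "(\<Inter>n. {s. real (Suc n) \<le> \<bar>s\<bar>}) = {}"
  proof -
    have "\<exists>n. \<not> real (Suc n) \<le> \<bar>s\<bar>" for s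
    proof -
      obtain n where "\<bar>s\<bar> < real n" using reals_Archimedean2 by blast
      then show ?thesis by (intro exI[of _ n]) simp
    qed
    then show ?thesis by blast
  qed
  finally have "(\<lambda>n. measure N {s. real (Suc n) \<le> \<bar>s\<bar>}) \<longlonglongrightarrow> 0"
    by simp
  from order_tendstoD(2)[OF this assms(3)] obtain n where "measure N {s. real (Suc n) \<le> \<bar>s\<bar>} < e"
    by (auto simp: eventually_sequentially)
  then show ?thesis by (intro that[of "real (Suc n)"]) auto
qed

lemmas variation_tail_small = finite_measure_tail_small[OF finite_variation_measure sets_variation_measure]

text \<open>
  As \<open>g\<close> vanishes at both infinities, \<open>g(x)\<close> is the limit of its increments between \<open>x\<close> and points
  that tend to the infinity on the same side of \<open>0\<close> as \<open>x\<close>.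
\<close>

lemma norm_le_variation_tail:
  assumes bv: "bounded_variation g" and "(g \<longlongrightarrow> 0) at_top" "(g \<longlongrightarrow> 0) at_bot"
  shows "norm (g x) \<le> measure (variation_measure g) {s. \<bar>x\<bar> \<le> \<bar>s\<bar>}"
proof -
  interpret finite_measure "variation_measure g" by (rule finite_variation_measure) fact
  let ?m = "measure (variation_measure g) {s. \<bar>x\<bar> \<le> \<bar>s\<bar>}"
  have le: "norm (g v - g u) \<le> ?m" if "u \<le> v" "\<And>s. s \<in> {u..v} \<Longrightarrow> \<bar>x\<bar> \<le> \<bar>s\<bar>" for u v
  proof -
    have "measure (variation_measure g) {u..v} \<le> ?m"
      using that(2) by (intro finite_measure_mono) auto
    then show ?thesis
      using increment_le_variation_function[OF bv that(1)]
        variation_function_diff_le_measure[OF bv that(1)] by linarith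
  qed
  show ?thesis
  proof (cases "0 \<le> x")
    case True
    have "((\<lambda>y. norm (g y - g x)) \<longlongrightarrow> norm (0 - g x)) at_top"
      by (intro tendsto_intros assms)
    moreover have "\<forall>\<^sub>F y in at_top. norm (g y - g x) \<le> ?m"
      using eventually_ge_at_top[of x] by eventually_elim (rule le, use True in auto)
    ultimately show ?thesis
      using tendsto_upperbound[of _ _ at_top] by force
  next
    case False
    have "((\<lambda>y. norm (g x - g y)) \<longlongrightarrow> norm (g x - 0)) at_bot"
      by (intro tendsto_intros assms)
    moreover have "\<forall>\<^sub>F y in at_bot. norm (g x - g y) \<le> ?m"
      using eventually_le_at_bot[of x] by eventually_elim (rule le, use False in auto)
    ultimately show ?thesis
      using tendsto_upperbound[of _ _ at_bot] by force
  qed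
qed

definition kbound_tail :: "(real \<Rightarrow> complex) \<Rightarrow> real \<Rightarrow> real \<Rightarrow> real \<Rightarrow> ennreal" where
  "kbound_tail g t a b = (\<integral>\<^sup>+s\<in>{s. s \<le> a \<or> b \<le> s}. ennreal (kbound s t) \<partial>variation_measure g)"

context
  fixes g :: "real \<Rightarrow> complex" and t :: real
  assumes bv: "bounded_variation g" and t: "t \<noteq> 0"
begin

interpretation finite_measure "variation_measure g"
  by (rule finite_variation_measure[OF bv])

lemma kern_stieltjes_diff_le_tail:
  assumes "a' \<le> a" "a < b" "b \<le> b'"
  shows "ennreal (norm (kern_stieltjes g t a' b' - kern_stieltjes g t a b)) \<le> 2 * kbound_tail g t a b"
proof -
  let ?J = "kern_stieltjes g t"
  have "?J a' b' = ?J a' a + ?J a b + ?J b b'"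
    using kern_stieltjes_combine[OF bv t, of a' b b'] kern_stieltjes_combine[OF bv t, of a' a b] assms
    by simp
  then have "ennreal (norm (?J a' b' - ?J a b)) \<le> ennreal (norm (?J a' a)) + ennreal (norm (?J b b'))"
    by (simp add: norm_triangle_ineq flip: ennreal_plus)
  also have "\<dots> \<le> 2 * (\<integral>\<^sup>+s\<in>{a'..a}. ennreal (kbound s t) \<partial>variation_measure g) +
      2 * (\<integral>\<^sup>+s\<in>{b..b'}. ennreal (kbound s t) \<partial>variation_measure g)"
    using assms by (intro add_mono kern_stieltjes_le_integral[OF bv t]) auto
  also have "\<dots> = 2 * (\<integral>\<^sup>+s\<in>{a'..a} \<union> {b..b'}. ennreal (kbound s t) \<partial>variation_measure g)"
    using assms by (subst nn_integral_disjoint_pair) (auto simp: distrib_left)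
  also have "\<dots> \<le> 2 * kbound_tail g t a b"
    unfolding kbound_tail_def
    by (intro mult_left_mono nn_integral_mono) (auto simp: indicator_def)
  finally show ?thesis .
qed

lemma kbound_tail_le:
  assumes "a \<le> - B" "B \<le> b"
  shows "kbound_tail g t a b \<le> ennreal (2 / \<bar>t\<bar> * measure (variation_measure g) {s. B \<le> \<bar>s\<bar>})"
proof -
  have "kbound_tail g t a b \<le> (\<integral>\<^sup>+s. ennreal (2 / \<bar>t\<bar>) * indicator {s. B \<le> \<bar>s\<bar>} s \<partial>variation_measure g)"
    unfolding kbound_tail_def using assms
    by (intro nn_integral_mono) (auto simp: indicator_def kbound_def intro!: ennreal_leI)
  also have "\<dots> = ennreal (2 / \<bar>t\<bar>) * emeasure (variation_measure g) {s. B \<le> \<bar>s\<bar>}"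
    by (rule nn_integral_cmult_indicator) simp
  also have "\<dots> = ennreal (2 / \<bar>t\<bar> * measure (variation_measure g) {s. B \<le> \<bar>s\<bar>})"
    unfolding emeasure_eq_measure by (rule ennreal_mult[symmetric]) auto
  finally show ?thesis .
qed

lemma kern_stieltjes_diff_le:
  assumes "a' \<le> a" "a < b" "b \<le> b'" "a \<le> - B" "B \<le> b"
  shows "norm (kern_stieltjes g t a' b' - kern_stieltjes g t a b)
    \<le> 4 / \<bar>t\<bar> * measure (variation_measure g) {s. B \<le> \<bar>s\<bar>}"
proof -
  have "ennreal (norm (kern_stieltjes g t a' b' - kern_stieltjes g t a b))
      \<le> 2 * ennreal (2 / \<bar>t\<bar> * measure (variation_measure g) {s. B \<le> \<bar>s\<bar>})"
    by (rule order_trans[OF kern_stieltjes_diff_le_tail[OF assms(1-3)]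
          mult_left_mono[OF kbound_tail_le[OF assms(4,5)] zero_le]])
  also have "\<dots> = ennreal (4 / \<bar>t\<bar> * measure (variation_measure g) {s. B \<le> \<bar>s\<bar>})"
    unfolding ennreal_numeral[symmetric] by (subst ennreal_mult[symmetric]) auto
  finally show ?thesis by (subst (asm) ennreal_le_iff) auto
qed

text \<open>
  Enlarging the interval changes the integral by at most \<open>4 / \<bar>t\<bar>\<close> times the mass of the variation
  measure far away from \<open>0\<close>.
\<close>

lemma convergent_kern_stieltjes: "convergent (\<lambda>n. kern_stieltjes g t (- real n) (real n))"
proof -
  have "Cauchy (\<lambda>n. kern_stieltjes g t (- real n) (real n))"
  proof (rule CauchyI')
    fix e :: real assume "0 < e"
    then obtain B where B: "0 < B" "measure (variation_measure g) {s. B \<le> \<bar>s\<bar>} < e * \<bar>t\<bar> / 4"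
      using variation_tail_small[OF bv, of "e * \<bar>t\<bar> / 4"] t by auto
    obtain N where N: "B \<le> real N" using real_arch_simple by blast
    show "\<exists>M. \<forall>m\<ge>M. \<forall>n>m. dist (kern_stieltjes g t (- real m) (real m))
        (kern_stieltjes g t (- real n) (real n)) < e"
    proof (intro exI allI impI)
      fix m n assume mn: "N \<le> m" "m < n"
      have "norm (kern_stieltjes g t (- real n) (real n) - kern_stieltjes g t (- real m) (real m))
          \<le> 4 / \<bar>t\<bar> * measure (variation_measure g) {s. B \<le> \<bar>s\<bar>}"
        using mn N B(1) by (intro kern_stieltjes_diff_le) auto
      also have "\<dots> < 4 / \<bar>t\<bar> * (e * \<bar>t\<bar> / 4)"
        using B(2) t by (intro mult_strict_left_mono) auto
      finally show "dist (kern_stieltjes g t (- real m) (real m))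
          (kern_stieltjes g t (- real n) (real n)) < e"
        using t by (simp add: dist_norm norm_minus_commute)
    qed
  qed
  then show ?thesis by (rule Cauchy_convergent)
qed

lemma norm_lim_kern_stieltjes_diff_le:
  assumes "a < b"
  shows "ennreal (norm (lim (\<lambda>n. kern_stieltjes g t (- real n) (real n)) - kern_stieltjes g t a b))
    \<le> 2 * kbound_tail g t a b"
proof (rule LIMSEQ_le_const2)
  let ?J = "kern_stieltjes g t"
  show "(\<lambda>n. ennreal (norm (?J (- real n) (real n) - ?J a b)))
     \<longlonglongrightarrow> ennreal (norm (lim (\<lambda>n. ?J (- real n) (real n)) - ?J a b))"
    by (intro tendsto_intros convergent_LIMSEQ_iff[THEN iffD1] convergent_kern_stieltjes)
  obtain N where "max \<bar>a\<bar> \<bar>b\<bar> \<le> real N" using real_arch_simple by blast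
  then show "\<exists>N. \<forall>n\<ge>N. ennreal (norm (?J (- real n) (real n) - ?J a b)) \<le> 2 * kbound_tail g t a b"
    using assms by (intro exI[of _ N] allI impI kern_stieltjes_diff_le_tail) auto
qed

context
  assumes top: "(g \<longlongrightarrow> 0) at_top" and bot: "(g \<longlongrightarrow> 0) at_bot"
begin

text \<open>
  Integration by parts on \<open>[a, b]\<close>: the boundary terms \<open>\<kappa>\<^sub>x(t) g(x)\<close> at \<open>x = a\<close> and \<open>x = b\<close> are at
  most \<open>2 / \<bar>t\<bar>\<close> times a tail of the variation measure, and so tend to \<open>0\<close>.
\<close>

lemma has_integral_neg_lim_kern_stieltjes:
  "((\<lambda>s. exp (- \<i> * of_real s * of_real t) * g s) has_integral
     - lim (\<lambda>n. kern_stieltjes g t (- real n) (real n))) UNIV"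
proof -
  let ?J = "kern_stieltjes g t" and ?m = "\<lambda>B. measure (variation_measure g) {s. B \<le> \<bar>s\<bar>}"
  let ?y = "lim (\<lambda>n. ?J (- real n) (real n))"
  let ?e = "\<lambda>s. exp (- \<i> * of_real s * of_real t) * g s"
  have "\<exists>B>0. \<forall>a b. ball 0 B \<subseteq> {a..b} \<longrightarrow> (\<exists>z. (?e has_integral z) {a..b} \<and> norm (z + ?y) < e)"
    if "0 < e" for e
  proof -
    obtain B where B: "0 < B" "?m B < e * \<bar>t\<bar> / 8"
      using variation_tail_small[OF bv, of "e * \<bar>t\<bar> / 8"] t \<open>0 < e\<close> by auto
    show ?thesis
    proof (intro exI[of _ B] conjI B allI impI)
      fix a b :: real assume "ball 0 B \<subseteq> {a..b}"
      then have "{- B<..<B} \<subseteq> {a..b}" by (auto simp: ball_def dist_real_def subset_eq)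
      then have ab: "a \<le> - B" "B \<le> b"
        using B(1) by (auto simp: greaterThanLessThan_subseteq_atLeastAtMost_iff)
      have bdry: "norm (kern x t * g x) \<le> 2 / \<bar>t\<bar> * ?m B" if "B \<le> \<bar>x\<bar>" for x
      proof -
        have "norm (g x) \<le> ?m B"
          using norm_le_variation_tail[OF bv top bot, of x] that
          by (elim order_trans) (intro finite_measure_mono, auto)
        moreover have "norm (kern x t) \<le> 2 / \<bar>t\<bar>" using norm_kern_le[of x t] by (simp add: kbound_def)
        ultimately show ?thesis unfolding norm_mult by (intro mult_mono) auto
      qed
      have "a < b" using ab B(1) by simp
      have "ennreal (norm (?y - ?J a b)) \<le> 2 * ennreal (2 / \<bar>t\<bar> * ?m B)"
        by (rule order_trans[OF norm_lim_kern_stieltjes_diff_le[OF \<open>a < b\<close>]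
              mult_left_mono[OF kbound_tail_le[OF ab] zero_le]])
      also have "\<dots> = ennreal (4 / \<bar>t\<bar> * ?m B)"
        unfolding ennreal_numeral[symmetric] by (subst ennreal_mult[symmetric]) auto
      finally have "norm (?y - ?J a b) \<le> 4 / \<bar>t\<bar> * ?m B"
        by (subst (asm) ennreal_le_iff) auto
      moreover have "norm (kern b t * g b) \<le> 2 / \<bar>t\<bar> * ?m B" "norm (kern a t * g a) \<le> 2 / \<bar>t\<bar> * ?m B"
        by (rule bdry, use ab B(1) in linarith)+
      moreover have "integral {a..b} ?e + ?y = (kern b t * g b - kern a t * g a) + (?y - ?J a b)"
        by (simp add: kern_stieltjes_def)
      moreover have "norm (x - y + z) \<le> norm x + norm y + norm z" for x y z :: complex
        using norm_triangle_ineq[of "x - y" z] norm_triangle_ineq4[of x y] by linarith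
      ultimately have "norm (integral {a..b} ?e + ?y) \<le> 2 / \<bar>t\<bar> * ?m B + 2 / \<bar>t\<bar> * ?m B + 4 / \<bar>t\<bar> * ?m B"
        by (smt (verit))
      also have "\<dots> = 8 / \<bar>t\<bar> * ?m B" by (simp add: algebra_simps)
      also have "\<dots> < 8 / \<bar>t\<bar> * (e * \<bar>t\<bar> / 8)"
        using B(2) t by (intro mult_strict_left_mono) auto
      also have "\<dots> = e" using t by simp
      finally have "norm (integral {a..b} ?e + ?y) < e" .
      then show "\<exists>z. (?e has_integral z) {a..b} \<and> norm (z + ?y) < e"
        using integrable_integral[OF integrable_on_exp_mult[OF bv]] by blast
    qed
  qed
  moreover have "\<not> (\<exists>a b. (UNIV :: real set) = cbox a b)"
    by (metis bounded_cbox not_bounded_UNIV)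
  ultimately show ?thesis
    by (subst has_integral_alt) (simp only: if_False UNIV_I if_True box_real diff_minus_eq_add, blast)
qed

lemma Fourier_BV_eq_lim: "Fourier_BV g t = - lim (\<lambda>n. kern_stieltjes g t (- real n) (real n))"
  unfolding Fourier_BV_def by (rule integral_unique[OF has_integral_neg_lim_kern_stieltjes])

lemma Fourier_BV_integrable_on: "(\<lambda>s. exp (- \<i> * of_real s * of_real t) * g s) integrable_on UNIV"
  using has_integral_neg_lim_kern_stieltjes by blast

lemma kern_stieltjes_tendsto_Fourier_BV:
  "(\<lambda>n. - kern_stieltjes g t (- real n) (real n)) \<longlonglongrightarrow> Fourier_BV g t"
  unfolding Fourier_BV_eq_lim
  by (intro tendsto_minus convergent_LIMSEQ_iff[THEN iffD1] convergent_kern_stieltjes)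

text \<open>
  Quantitative form of \<open>g\<^sup>^(t) = - \<integral> \<kappa>\<^sub>s(t) dg(s)\<close>.  The bound depends on \<open>t\<close> only through \<open>h\<^sub>s(t)\<close>, so
  that it can be integrated against \<open>\<bar>f\<bar>\<close>.
\<close>

lemma norm_Fourier_BV_add_le:
  assumes "a < b"
  shows "ennreal (norm (Fourier_BV g t + kern_stieltjes g t a b)) \<le> 2 * kbound_tail g t a b"
  using norm_lim_kern_stieltjes_diff_le[OF assms] unfolding Fourier_BV_eq_lim
  by (simp add: norm_minus_commute)

lemma norm_Fourier_BV_le:
  "ennreal (norm (Fourier_BV g t)) \<le> 2 * (\<integral>\<^sup>+s. ennreal (kbound s t) \<partial>variation_measure g)"
proof (rule LIMSEQ_le_const2)
  show "(\<lambda>n. ennreal (norm (- kern_stieltjes g t (- real n) (real n))))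
      \<longlonglongrightarrow> ennreal (norm (Fourier_BV g t))"
    by (intro tendsto_intros kern_stieltjes_tendsto_Fourier_BV)
  have "ennreal (norm (- kern_stieltjes g t (- real n) (real n)))
      \<le> 2 * (\<integral>\<^sup>+s. ennreal (kbound s t) \<partial>variation_measure g)" for n
  proof -
    have "ennreal (norm (- kern_stieltjes g t (- real n) (real n))) \<le>
        2 * (\<integral>\<^sup>+s\<in>{- real n..real n}. ennreal (kbound s t) \<partial>variation_measure g)"
      unfolding norm_minus_cancel by (intro kern_stieltjes_le_integral bv t) auto
    also have "\<dots> \<le> 2 * (\<integral>\<^sup>+s. ennreal (kbound s t) \<partial>variation_measure g)"
      by (intro mult_left_mono nn_integral_mono) (auto simp: indicator_def)
    finally show ?thesis .
  qed
  then show "\<exists>N. \<forall>n\<ge>N. ennreal (norm (- kern_stieltjes g t (- real n) (real n)))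
      \<le> 2 * (\<integral>\<^sup>+s. ennreal (kbound s t) \<partial>variation_measure g)" by blast
qed

end

end

lemma borel_measurable_Fourier_BV:
  assumes bv: "bounded_variation g" and lim: "(g \<longlongrightarrow> 0) at_top" "(g \<longlongrightarrow> 0) at_bot"
  shows "Fourier_BV g \<in> borel_measurable borel"
proof (rule borel_measurable_LIMSEQ_metric)
  fix t :: real
  show "(\<lambda>n. if t = 0 then Fourier_BV g 0 else - kern_stieltjes g t (- real n) (real n))
      \<longlonglongrightarrow> Fourier_BV g t"
    using kern_stieltjes_tendsto_Fourier_BV[OF bv _ lim] by (cases "t = 0") auto
qed (use measurable_kern_stieltjes[OF bv] in measurable)

section \<open>The pairing as a Stieltjes integral\<close>

lemma has_HS_integral_on_unique:
  "has_HS_integral_on F g a b y \<Longrightarrow> has_HS_integral_on F g a b z \<Longrightarrow> y = z"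
  unfolding has_HS_integral_on_def by (rule tendsto_unique[OF division_filter_not_empty])

lemma has_HS_integral_unique:
  assumes "has_HS_integral F g I" "has_HS_integral F g I'"
  shows "I = I'"
proof (rule ccontr)
  assume "I \<noteq> I'"
  then have e: "0 < norm (I - I') / 2" by simp
  obtain B where B: "0 < B" "\<And>a b. ball 0 B \<subseteq> cbox a b \<Longrightarrow>
      \<exists>z. has_HS_integral_on F g a b z \<and> norm (z - I) < norm (I - I') / 2"
    using assms(1) e unfolding has_HS_integral_def by blast
  obtain B' where B': "0 < B'" "\<And>a b. ball 0 B' \<subseteq> cbox a b \<Longrightarrow>
      \<exists>z. has_HS_integral_on F g a b z \<and> norm (z - I') < norm (I - I') / 2"
    using assms(2) e unfolding has_HS_integral_def by blast
  define C where "C = max B B'"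
  have "ball 0 B \<subseteq> cbox (- C) C" "ball 0 B' \<subseteq> cbox (- C) C"
    by (auto simp: C_def dist_real_def)
  from B(2)[OF this(1)] B'(2)[OF this(2)] obtain z z' where
    z: "has_HS_integral_on F g (- C) C z" "norm (z - I) < norm (I - I') / 2" and
    z': "has_HS_integral_on F g (- C) C z'" "norm (z' - I') < norm (I - I') / 2" by blast
  have "z = z'" using z(1) z'(1) by (rule has_HS_integral_on_unique)
  then have "norm (I - I') < norm (I - I')"
    using z(2) z'(2) norm_triangle_ineq[of "z - I'" "I - z"] by (simp add: norm_minus_commute)
  then show False by simp
qed

lemma HS_integral_unique: "has_HS_integral F g I \<Longrightarrow> HS_integral F g = I"
  unfolding HS_integral_def by (blast intro: the_equality has_HS_integral_unique)

lemma sigma_finite_lebesgue: "sigma_finite_measure (lebesgue :: real measure)"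
proof
  have "{- real n..real n} \<in> sets lebesgue \<and> emeasure lebesgue {- real n..real n} \<noteq> \<infinity>" for n
    by (simp add: emeasure_lborel_Icc_eq)
  moreover have "(\<Union>n. {- real n..real n}) = UNIV"
  proof (intro set_eqI iffI UNIV_I)
    fix x :: real
    obtain n where "\<bar>x\<bar> \<le> real n" using real_arch_simple by blast
    then show "x \<in> (\<Union>n. {- real n..real n})" by (auto intro!: exI[of _ n])
  qed
  ultimately show "\<exists>A::real set set. countable A \<and> A \<subseteq> sets lebesgue \<and> \<Union>A = space lebesgue
      \<and> (\<forall>a\<in>A. emeasure lebesgue a \<noteq> \<infinity>)"
    by (intro exI[of _ "range (\<lambda>n. {- real n..real n})"]) auto
qed

lemma measurable_ident_lebesgue: "(\<lambda>x::real. x) \<in> borel_measurable lebesgue"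
  by (intro measurable_completion) simp

lemma AE_lebesgue_nonzero: "AE t in (lebesgue :: real measure). t \<noteq> 0"
  by (intro AE_completion AE_lborel_singleton)

lemma measurable_lebesgue_kbound: "kbound s \<in> borel_measurable lebesgue"
  by (intro measurable_completion) simp

text \<open>
  The exchange of the integrals does not depend on the exponents.  It only needs a weight \<open>w\<close> that
  bounds \<open>\<integral> h\<^sub>s \<bar>f\<bar>\<close>, tends to \<open>0\<close> at \<open>0\<close>, and is integrable with respect to \<open>\<bar>dg\<bar>\<close>.
\<close>

locale kernel_bounded_pairing =
  fixes f g :: "real \<Rightarrow> complex" and L :: real and w :: "real \<Rightarrow> real"
  assumes f [measurable]: "f \<in> borel_measurable lebesgue"
    and bv: "bounded_variation g"
    and lim: "(g \<longlongrightarrow> 0) at_top" "(g \<longlongrightarrow> 0) at_bot"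
    and L: "0 \<le> L" and w_nonneg: "\<And>s. 0 \<le> w s" and w [measurable]: "w \<in> borel_measurable borel"
    and w_0: "(w \<longlongrightarrow> 0) (at_right 0)"
    and kbound_le: "\<And>s. (\<integral>\<^sup>+t. ennreal (kbound s t * norm (f t)) \<partial>lebesgue) \<le> ennreal (L * w s)"
    and w_integrable: "(\<integral>\<^sup>+s. ennreal (w s) \<partial>variation_measure g) < \<infinity>"
begin

lemma integrable_mult_f:
  assumes [measurable]: "X \<in> borel_measurable lebesgue" and "0 \<le> c"
    and le: "AE t in lebesgue. norm (X t) \<le> c * kbound s t"
  shows "integrable lebesgue (\<lambda>t. X t * f t)"
    and "norm (LINT t|lebesgue. X t * f t) \<le> c * (L * w s)"
proof -
  have "(\<integral>\<^sup>+t. ennreal (norm (X t * f t)) \<partial>lebesgue) \<le>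
      (\<integral>\<^sup>+t. ennreal c * ennreal (kbound s t * norm (f t)) \<partial>lebesgue)"
    using le by (intro nn_integral_mono_AE)
      (auto simp: norm_mult ennreal_mult'[symmetric] \<open>0 \<le> c\<close> mult.assoc[symmetric]
        intro!: ennreal_leI mult_right_mono elim!: eventually_mono)
  also have "\<dots> = ennreal c * (\<integral>\<^sup>+t. ennreal (kbound s t * norm (f t)) \<partial>lebesgue)"
    using measurable_lebesgue_kbound[of s] by (intro nn_integral_cmult) simp
  also have "\<dots> \<le> ennreal c * ennreal (L * w s)"
    by (intro mult_left_mono kbound_le) simp
  also have "\<dots> = ennreal (c * (L * w s))"
    by (rule ennreal_mult'[symmetric]) fact
  finally have le: "(\<integral>\<^sup>+t. ennreal (norm (X t * f t)) \<partial>lebesgue) \<le> ennreal (c * (L * w s))" .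
  show int: "integrable lebesgue (\<lambda>t. X t * f t)"
    by (rule integrableI_bounded) (use le in \<open>auto simp: less_top[symmetric] top_unique\<close>)
  have "ennreal (norm (LINT t|lebesgue. X t * f t)) \<le> ennreal (c * (L * w s))"
    using integral_norm_bound_ennreal[OF int] le by (rule order_trans)
  then show "norm (LINT t|lebesgue. X t * f t) \<le> c * (L * w s)"
    using L w_nonneg \<open>0 \<le> c\<close> by (subst (asm) ennreal_le_iff) auto
qed

lemma measurable_lebesgue_kern: "kern s \<in> borel_measurable lebesgue"
  by (intro measurable_completion) simp

lemma measurable_lebesgue_kern_stieltjes: "(\<lambda>t. kern_stieltjes g t u v) \<in> borel_measurable lebesgue"
  using measurable_kern_stieltjes[OF bv] by (intro measurable_completion) simp

lemma measurable_lebesgue_Fourier_BV: "Fourier_BV g \<in> borel_measurable lebesgue"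
  using borel_measurable_Fourier_BV[OF bv lim] by (intro measurable_completion) simp

lemma integrable_kern_mult_f: "integrable lebesgue (\<lambda>t. kern s t * f t)"
  by (rule integrable_mult_f(1)[OF measurable_lebesgue_kern, where c = 1 and s = s]) (auto simp: norm_kern_le)

lemma Fourier_primitive_eq: "Fourier_primitive f s = (LINT t|lebesgue. kern s t * f t)"
  by (simp add: Fourier_primitive_def kern_def del: exp_minus)

text \<open>
  Besides \<open>2 / \<bar>t\<bar>\<close> times the variation, the integral is bounded by \<open>\<bar>a\<bar> + (b - a)\<close> times the
  variation, which takes care of small \<open>t\<close>.
\<close>

lemma integrable_kern_stieltjes_mult_f:
  assumes "a \<le> b"
  shows "integrable lebesgue (\<lambda>t. kern_stieltjes g t a b * f t)"
proof (rule integrable_mult_f(1)[OF measurable_lebesgue_kern_stieltjes])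
  let ?D = "variation_function g b - variation_function g a"
  have D: "0 \<le> ?D" using monoD[OF mono_variation_function[OF bv] assms] by simp
  show "AE t in lebesgue. norm (kern_stieltjes g t a b) \<le> ?D * kbound (\<bar>a\<bar> + (b - a)) t"
    using AE_lebesgue_nonzero
  proof eventually_elim
    fix t :: real assume t: "t \<noteq> 0"
    have "norm (kern a t) \<le> \<bar>a\<bar>"
      using norm_kern_le[of a t] by (simp add: kbound_def)
    then have "norm (kern a t * (g b - g a)) \<le> \<bar>a\<bar> * ?D"
      unfolding norm_mult using increment_le_variation_function[OF bv assms] by (intro mult_mono) auto
    then have "norm (kern_stieltjes g t a b) \<le> (\<bar>a\<bar> + (b - a)) * ?D"
      using kern_stieltjes_approx[OF bv t, of a a b] assms
        norm_triangle_sub[of "kern_stieltjes g t a b" "kern a t * (g b - g a)"]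
      by (simp add: algebra_simps)
    with kern_stieltjes_le_variation[OF bv t assms] assms
    show "norm (kern_stieltjes g t a b) \<le> ?D * kbound (\<bar>a\<bar> + (b - a)) t"
      by (simp add: kbound_def min_def mult.commute)
  qed
  show "0 \<le> ?D" by (rule D)
qed

text \<open>
  The integral is additive and the variation function telescopes over a tagged division, so the
  estimates for the single intervals add up.
\<close>

lemma kern_stieltjes_riemann_sum:
  assumes "a \<le> b" and D: "D tagged_division_of cbox a b" "(\<lambda>x. ball x (d / 2)) fine D"
    and "0 < d" and t: "t \<noteq> 0"
  shows "norm ((\<Sum>(x, K)\<in>D. kern x t * (g (Sup K) - g (Inf K))) - kern_stieltjes g t a b)
    \<le> 2 * (variation_function g b - variation_function g a) * kbound d t"
proof -
  let ?V = "variation_function g" and ?J = "kern_stieltjes g t"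
  have K: "\<exists>u v. K = {u..v} \<and> u \<le> x \<and> x \<le> v \<and> a \<le> u \<and> v \<le> b \<and> v - u \<le> d \<and> Inf K = u \<and> Sup K = v"
    if xK: "(x, K) \<in> D" for x K
  proof -
    obtain u v where uv: "K = {u..v}"
      using tagged_division_ofD(4)[OF D(1) xK] by auto
    have x: "u \<le> x" "x \<le> v" and "{u..v} \<subseteq> {a..b}"
      using tagged_division_ofD(2,3)[OF D(1) xK] uv by auto
    moreover have sub: "{u..v} \<subseteq> ball x (d / 2)"
      using D(2) xK uv by (auto simp: fine_def)
    have "u \<in> ball x (d / 2)" "v \<in> ball x (d / 2)"
      by (rule subsetD[OF sub], use x in simp)+
    ultimately show ?thesis
      using uv by (intro exI[of _ u] exI[of _ v]) (auto simp: dist_real_def)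
  qed
  have tel: "(\<Sum>(x, K)\<in>D. F (Sup K) - F (Inf K)) = F b - F a" for F :: "real \<Rightarrow> 'z::real_normed_vector"
    using additive_tagged_division_1[OF assms(1)] D(1) by simp
  have "?J a b = (\<Sum>(x, K)\<in>D. ?J a (Sup K) - ?J a (Inf K))"
    by (subst tel) (simp add: kern_stieltjes_def)
  also have "\<dots> = (\<Sum>(x, K)\<in>D. ?J (Inf K) (Sup K))"
  proof (intro sum.cong refl, clarify)
    fix x K assume "(x, K) \<in> D"
    from K[OF this] show "?J a (Sup K) - ?J a (Inf K) = ?J (Inf K) (Sup K)"
      using kern_stieltjes_combine[OF bv t, of a "Inf K" "Sup K"] by auto
  qed
  finally have "(\<Sum>(x, K)\<in>D. kern x t * (g (Sup K) - g (Inf K))) - ?J a b =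
      (\<Sum>(x, K)\<in>D. kern x t * (g (Sup K) - g (Inf K)) - ?J (Inf K) (Sup K))"
    by (simp add: sum_subtractf case_prod_unfold)
  also have "norm \<dots> \<le> (\<Sum>(x, K)\<in>D. 2 * kbound d t * (?V (Sup K) - ?V (Inf K)))"
  proof (intro sum_norm_le, clarify)
    fix x K assume "(x, K) \<in> D"
    from K[OF this] show "norm (kern x t * (g (Sup K) - g (Inf K)) - ?J (Inf K) (Sup K))
        \<le> 2 * kbound d t * (?V (Sup K) - ?V (Inf K))"
      using kern_stieltjes_approx_kbound[OF bv t, of "Inf K" x "Sup K" d]
      by (auto simp: norm_minus_commute)
  qed
  also have "\<dots> = 2 * kbound d t * (\<Sum>(x, K)\<in>D. ?V (Sup K) - ?V (Inf K))"
    by (simp add: sum_distrib_left case_prod_unfold)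
  also have "\<dots> = 2 * (?V b - ?V a) * kbound d t"
    unfolding tel by simp
  finally show ?thesis .
qed

text \<open>
  A Stieltjes sum of \<open>\<Psi>\<^sub>f\<close> is the integral of \<open>f\<close> times the corresponding sum of \<open>\<kappa>\<close>.  For a mesh
  below \<open>d\<close> its distance from the integral is at most a multiple of \<open>\<integral> h\<^sub>d \<bar>f\<bar> \<le> L w(d)\<close>.
\<close>

lemma has_HS_integral_on_Fourier_primitive:
  assumes "a \<le> b"
  shows "has_HS_integral_on (Fourier_primitive f) g a b (LINT t|lebesgue. kern_stieltjes g t a b * f t)"
  unfolding has_HS_integral_on_def tendsto_iff
proof (intro allI impI)
  let ?c = "2 * (variation_function g b - variation_function g a)"
  let ?I = "LINT t|lebesgue. kern_stieltjes g t a b * f t"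
  fix e :: real assume "0 < e"
  have c: "0 \<le> ?c" using monoD[OF mono_variation_function[OF bv] assms] by simp
  have "((\<lambda>d. ?c * (L * w d)) \<longlongrightarrow> ?c * (L * 0)) (at_right 0)"
    by (intro tendsto_intros w_0)
  then have "\<forall>\<^sub>F d in at_right 0. ?c * (L * w d) < e"
    using \<open>0 < e\<close> by (intro order_tendstoD(2)) auto
  moreover have "\<forall>\<^sub>F d :: real in at_right 0. 0 < d"
    by (rule eventually_at_right_less)
  ultimately have "\<forall>\<^sub>F d in at_right 0. ?c * (L * w d) < e \<and> 0 < d"
    by (rule eventually_conj)
  then have "\<exists>d. ?c * (L * w d) < e \<and> 0 < d"
    by (rule eventually_happens'[rotated]) simp
  then obtain d where d: "0 < d" "?c * (L * w d) < e" by blast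
  have "dist (\<Sum>(x, K)\<in>D. Fourier_primitive f x * (g (Sup K) - g (Inf K))) ?I < e"
    if D: "D tagged_division_of cbox a b" "(\<lambda>x. ball x (d / 2)) fine D" for D
  proof -
    let ?X = "\<lambda>t. (\<Sum>(x, K)\<in>D. kern x t * (g (Sup K) - g (Inf K))) - kern_stieltjes g t a b"
    note [measurable] = measurable_lebesgue_kern measurable_lebesgue_kern_stieltjes
    have "(\<Sum>(x, K)\<in>D. Fourier_primitive f x * (g (Sup K) - g (Inf K))) =
        (LINT t|lebesgue. (\<Sum>(x, K)\<in>D. kern x t * f t * (g (Sup K) - g (Inf K))))"
      unfolding Fourier_primitive_eq case_prod_unfold
      by (subst Bochner_Integration.integral_sum)
        (auto intro!: integrable_mult_left integrable_kern_mult_f)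
    also have "\<dots> - ?I = (LINT t|lebesgue. ?X t * f t)"
    proof -
      have "(\<Sum>(x, K)\<in>D. kern x t * f t * (g (Sup K) - g (Inf K))) - kern_stieltjes g t a b * f t = ?X t * f t"
        for t
        unfolding left_diff_distrib sum_distrib_right case_prod_unfold by (simp add: mult_ac)
      moreover have int: "integrable lebesgue (\<lambda>t. \<Sum>(x, K)\<in>D. kern x t * f t * (g (Sup K) - g (Inf K)))"
        unfolding case_prod_unfold
        by (intro Bochner_Integration.integrable_sum integrable_mult_left integrable_kern_mult_f)
      ultimately show ?thesis
        using Bochner_Integration.integral_diff[OF int integrable_kern_stieltjes_mult_f[OF assms]] by simp
    qed
    also have "norm \<dots> \<le> ?c * (L * w d)"
    proof (rule integrable_mult_f(2)[OF _ c])
      show "AE t in lebesgue. norm (?X t) \<le> ?c * kbound d t"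
        using AE_lebesgue_nonzero
        by eventually_elim (rule kern_stieltjes_riemann_sum[OF assms D d(1)])
    qed measurable
    finally show ?thesis using d(2) by (simp add: dist_norm)
  qed
  then show "\<forall>\<^sub>F D in division_filter (cbox a b).
      dist (\<Sum>(x, K)\<in>D. Fourier_primitive f x * (g (Sup K) - g (Inf K))) ?I < e"
    unfolding eventually_division_filter
    using d(1) by (intro exI[of _ "\<lambda>x. ball x (d / 2)"]) auto
qed

text \<open>
  Exchanging the integrations leaves the inner integral \<open>\<integral> h\<^sub>s \<bar>f\<bar> \<le> L w(s)\<close>.
\<close>

lemma tonelli_kbound_le:
  assumes S [measurable]: "S \<in> sets borel"
  shows "(\<integral>\<^sup>+t. (\<integral>\<^sup>+s\<in>S. ennreal (kbound s t) \<partial>variation_measure g) * ennreal (norm (f t)) \<partial>lebesgue)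
    \<le> ennreal L * (\<integral>\<^sup>+s\<in>S. ennreal (w s) \<partial>variation_measure g)"
proof -
  let ?\<mu> = "variation_measure g"
  interpret finite_measure ?\<mu> by (rule finite_variation_measure[OF bv])
  interpret pair_sigma_finite "lebesgue :: real measure" ?\<mu>
    by (intro pair_sigma_finite.intro sigma_finite_lebesgue sigma_finite_measure_axioms)
  have [measurable]: "fst \<in> borel_measurable ((lebesgue :: real measure) \<Otimes>\<^sub>M ?\<mu>)"
    by (rule measurable_compose[OF measurable_fst measurable_ident_lebesgue])
  have kb [measurable]: "(\<lambda>x. kbound (snd x) (fst x)) \<in> borel_measurable (lebesgue \<Otimes>\<^sub>M ?\<mu>)"
    unfolding kbound_def by measurable
  note kb2 = measurable_lebesgue_kbound
  have "(\<integral>\<^sup>+t. (\<integral>\<^sup>+s\<in>S. ennreal (kbound s t) \<partial>?\<mu>) * ennreal (norm (f t)) \<partial>lebesgue) =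
      (\<integral>\<^sup>+t. (\<integral>\<^sup>+s. ennreal (kbound s t * norm (f t)) * indicator S s \<partial>?\<mu>) \<partial>lebesgue)"
    by (intro nn_integral_cong, subst nn_integral_multc[symmetric]) (auto simp: ennreal_mult' ac_simps)
  also have "\<dots> = (\<integral>\<^sup>+s. (\<integral>\<^sup>+t. ennreal (kbound s t * norm (f t)) * indicator S s \<partial>lebesgue) \<partial>?\<mu>)"
    by (rule Fubini'[symmetric]) (simp add: case_prod_beta', measurable)
  also have "\<dots> \<le> (\<integral>\<^sup>+s. ennreal L * (ennreal (w s) * indicator S s) \<partial>?\<mu>)"
  proof (rule nn_integral_mono)
    fix s
    have "(\<integral>\<^sup>+t. ennreal (kbound s t * norm (f t)) * indicator S s \<partial>lebesgue) =
        (\<integral>\<^sup>+t. ennreal (kbound s t * norm (f t)) \<partial>lebesgue) * indicator S s"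
      using kb2[of s] by (intro nn_integral_multc) simp
    also have "\<dots> \<le> ennreal (L * w s) * indicator S s"
      by (intro mult_right_mono kbound_le) simp
    finally show "(\<integral>\<^sup>+t. ennreal (kbound s t * norm (f t)) * indicator S s \<partial>lebesgue)
        \<le> ennreal L * (ennreal (w s) * indicator S s)"
      using L by (simp add: ennreal_mult' ac_simps)
  qed
  also have "\<dots> = ennreal L * (\<integral>\<^sup>+s\<in>S. ennreal (w s) \<partial>?\<mu>)"
    by (intro nn_integral_cmult) auto
  finally show ?thesis .
qed

lemma nn_integral_le_tonelli:
  assumes [measurable]: "S \<in> sets borel"
    and le: "\<And>t. t \<noteq> 0 \<Longrightarrow> ennreal (norm (X t)) \<le> 2 * (\<integral>\<^sup>+s\<in>S. ennreal (kbound s t) \<partial>variation_measure g)"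
  shows "(\<integral>\<^sup>+t. ennreal (norm (X t * f t)) \<partial>lebesgue)
    \<le> 2 * (ennreal L * (\<integral>\<^sup>+s\<in>S. ennreal (w s) \<partial>variation_measure g))"
proof -
  let ?\<mu> = "variation_measure g"
  interpret finite_measure ?\<mu> by (rule finite_variation_measure[OF bv])
  have [measurable]: "(\<lambda>t. \<integral>\<^sup>+s\<in>S. ennreal (kbound s t) \<partial>?\<mu>) \<in> borel_measurable lebesgue"
  proof (intro measurable_completion)
    have "(\<lambda>x. kbound (snd x) (fst x)) \<in> borel_measurable (lborel \<Otimes>\<^sub>M ?\<mu>)"
      unfolding kbound_def by measurable
    then show "(\<lambda>t. \<integral>\<^sup>+s\<in>S. ennreal (kbound s t) \<partial>?\<mu>) \<in> borel_measurable lborel"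
      by (intro borel_measurable_nn_integral) (simp add: case_prod_beta', measurable)
  qed
  have "(\<integral>\<^sup>+t. ennreal (norm (X t * f t)) \<partial>lebesgue) \<le>
      (\<integral>\<^sup>+t. 2 * ((\<integral>\<^sup>+s\<in>S. ennreal (kbound s t) \<partial>?\<mu>) * ennreal (norm (f t))) \<partial>lebesgue)"
  proof (rule nn_integral_mono_AE)
    show "AE t in lebesgue. ennreal (norm (X t * f t)) \<le>
        2 * ((\<integral>\<^sup>+s\<in>S. ennreal (kbound s t) \<partial>?\<mu>) * ennreal (norm (f t)))"
      using AE_lebesgue_nonzero
    proof eventually_elim
      fix t :: real assume "t \<noteq> 0"
      from mult_right_mono[OF le[OF this], of "ennreal (norm (f t))"]
      show "ennreal (norm (X t * f t)) \<le> 2 * ((\<integral>\<^sup>+s\<in>S. ennreal (kbound s t) \<partial>?\<mu>) * ennreal (norm (f t)))"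
        by (simp add: norm_mult ennreal_mult' mult.assoc)
    qed
  qed
  also have "\<dots> = 2 * (\<integral>\<^sup>+t. (\<integral>\<^sup>+s\<in>S. ennreal (kbound s t) \<partial>?\<mu>) * ennreal (norm (f t)) \<partial>lebesgue)"
    by (intro nn_integral_cmult) measurable
  also have "\<dots> \<le> 2 * (ennreal L * (\<integral>\<^sup>+s\<in>S. ennreal (w s) \<partial>?\<mu>))"
    by (intro mult_left_mono tonelli_kbound_le) auto
  finally show ?thesis .
qed

lemma
  shows integrable_Fourier_BV_mult_f: "integrable lebesgue (\<lambda>t. Fourier_BV g t * f t)"
    and norm_integral_Fourier_BV_le: "ennreal (norm (LINT t|lebesgue. Fourier_BV g t * f t))
      \<le> 2 * (ennreal L * (\<integral>\<^sup>+s. ennreal (w s) \<partial>variation_measure g))"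
proof -
  have le: "(\<integral>\<^sup>+t. ennreal (norm (Fourier_BV g t * f t)) \<partial>lebesgue)
      \<le> 2 * (ennreal L * (\<integral>\<^sup>+s. ennreal (w s) \<partial>variation_measure g))"
    using nn_integral_le_tonelli[of UNIV "Fourier_BV g"] norm_Fourier_BV_le[OF bv _ lim] by simp
  also have "\<dots> < \<infinity>"
    using w_integrable by (simp add: ennreal_mult_less_top)
  finally show int: "integrable lebesgue (\<lambda>t. Fourier_BV g t * f t)"
    using measurable_lebesgue_Fourier_BV by (intro integrableI_bounded) auto
  show "ennreal (norm (LINT t|lebesgue. Fourier_BV g t * f t))
      \<le> 2 * (ennreal L * (\<integral>\<^sup>+s. ennreal (w s) \<partial>variation_measure g))"
    using integral_norm_bound_ennreal[OF int] le by (rule order_trans)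
qed

lemma w_tail_small:
  assumes "0 < e"
  obtains B where "0 < B" "(\<integral>\<^sup>+s\<in>{s. B \<le> \<bar>s\<bar>}. ennreal (w s) \<partial>variation_measure g) < ennreal e"
proof -
  let ?N = "density (variation_measure g) w"
  interpret finite_measure ?N
    by (rule finite_measureI) (use w_integrable in \<open>simp add: emeasure_density\<close>)
  obtain B where "0 < B" "measure ?N {s. B \<le> \<bar>s\<bar>} < e"
    using finite_measure_tail_small[OF finite_measure_axioms _ assms] by auto
  then show ?thesis
    using assms by (intro that[of B])
      (auto simp: emeasure_density[symmetric] emeasure_eq_measure ennreal_less_iff)
qed

lemma has_HS_integral_Fourier_primitive:
  "has_HS_integral (Fourier_primitive f) g (- (LINT t|lebesgue. Fourier_BV g t * f t))"
  unfolding has_HS_integral_def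
proof (intro allI impI)
  let ?F = "LINT t|lebesgue. Fourier_BV g t * f t"
  fix e :: real assume "0 < e"
  then have "0 < e / (2 * L + 1)" using L by simp
  from w_tail_small[OF this] obtain B where B: "0 < B"
    "(\<integral>\<^sup>+s\<in>{s. B \<le> \<bar>s\<bar>}. ennreal (w s) \<partial>variation_measure g) < ennreal (e / (2 * L + 1))" .
  show "\<exists>B>0. \<forall>a b. ball 0 B \<subseteq> cbox a b \<longrightarrow>
      (\<exists>z. has_HS_integral_on (Fourier_primitive f) g a b z \<and> norm (z - - ?F) < e)"
  proof (intro exI[of _ B] conjI B allI impI)
    fix a b :: real assume "ball 0 B \<subseteq> cbox a b"
    then have "{- B<..<B} \<subseteq> {a..b}" by (auto simp: ball_def dist_real_def subset_eq)
    then have ab: "a \<le> - B" "B \<le> b"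
      using B(1) by (auto simp: greaterThanLessThan_subseteq_atLeastAtMost_iff)
    then have lt: "a < b" using B(1) by simp
    let ?I = "LINT t|lebesgue. kern_stieltjes g t a b * f t"
    let ?X = "\<lambda>t. Fourier_BV g t + kern_stieltjes g t a b"
    have int: "integrable lebesgue (\<lambda>t. ?X t * f t)"
      unfolding distrib_right
      by (intro Bochner_Integration.integrable_add integrable_Fourier_BV_mult_f
          integrable_kern_stieltjes_mult_f) (use lt in simp)
    have "?I - - ?F = (LINT t|lebesgue. ?X t * f t)"
      unfolding distrib_right using lt
      by (subst Bochner_Integration.integral_add[OF integrable_Fourier_BV_mult_f
          integrable_kern_stieltjes_mult_f]) simp_all
    then have "ennreal (norm (?I - - ?F)) \<le> (\<integral>\<^sup>+t. ennreal (norm (?X t * f t)) \<partial>lebesgue)"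
      using integral_norm_bound_ennreal[OF int] by simp
    also have "\<dots> \<le> 2 * (ennreal L * (\<integral>\<^sup>+s\<in>{s. s \<le> a \<or> b \<le> s}. ennreal (w s) \<partial>variation_measure g))"
      using norm_Fourier_BV_add_le[OF bv _ lim lt] unfolding kbound_tail_def
      by (intro nn_integral_le_tonelli) auto
    also have "\<dots> \<le> 2 * (ennreal L * (\<integral>\<^sup>+s\<in>{s. B \<le> \<bar>s\<bar>}. ennreal (w s) \<partial>variation_measure g))"
      using ab B(1) by (intro mult_left_mono nn_integral_mono) (auto simp: indicator_def)
    also have "\<dots> \<le> 2 * (ennreal L * ennreal (e / (2 * L + 1)))"
      using B(2) by (intro mult_left_mono) auto
    also have "\<dots> = ennreal (2 * (L * (e / (2 * L + 1))))"
      using L \<open>0 < e\<close> by (simp add: ennreal_mult' del: times_divide_eq_right)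
    finally have "norm (?I - - ?F) \<le> 2 * (L * (e / (2 * L + 1)))"
      using L \<open>0 < e\<close> by (subst (asm) ennreal_le_iff) auto
    also have "\<dots> < e"
      using L \<open>0 < e\<close> by (simp add: field_simps)
    finally show "\<exists>z. has_HS_integral_on (Fourier_primitive f) g a b z \<and> norm (z - - ?F) < e"
      using has_HS_integral_on_Fourier_primitive[of a b] lt by auto
  qed
qed

lemma Fourier_pairing_eq: "Fourier_pairing f g = (LINT t|lebesgue. f t * Fourier_BV g t)"
  unfolding Fourier_pairing_def HS_integral_unique[OF has_HS_integral_Fourier_primitive]
  by (simp add: mult.commute)

end

section \<open>Variable exponents\<close>

text \<open>
  The reciprocal exponent is a real number in \<open>[0, 1]\<close>, with the value \<open>0\<close> for the exponent \<open>\<infinity>\<close>.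
  Conditions on \<open>p\<close> and \<open>q\<close> become linear in terms of it.
\<close>

definition inv_exponent :: "(real \<Rightarrow> ennreal) \<Rightarrow> real \<Rightarrow> real" where
  "inv_exponent p t = enn2real (1 / p t)"

lemma one_divide_ennreal_le_one: "1 \<le> x \<Longrightarrow> 1 / x \<le> (1::ennreal)"
  by (cases x) (auto simp: divide_ennreal simp flip: ennreal_1)

lemma one_divide_ennreal_antimono: "1 \<le> x \<Longrightarrow> x \<le> y \<Longrightarrow> 1 / y \<le> 1 / (x :: ennreal)"
  by (cases x; cases y) (auto simp: divide_ennreal frac_le top_unique simp flip: ennreal_1)

lemma one_divide_one_divide_ennreal: "1 \<le> x \<Longrightarrow> 1 / (1 / x) = (x :: ennreal)"
  by (cases x) (auto simp: divide_ennreal simp flip: ennreal_1)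

lemma inv_exponent_infinity: "p t = \<infinity> \<Longrightarrow> inv_exponent p t = 0"
  by (simp add: inv_exponent_def)

lemma inv_exponent_eq:
  assumes "1 \<le> p t" "p t \<noteq> \<infinity>"
  shows "1 \<le> enn2real (p t)" "inv_exponent p t = 1 / enn2real (p t)"
  using assms by (cases "p t"; simp add: inv_exponent_def divide_ennreal flip: ennreal_1)+

lemma conjugate_exponents_ge_one:
  assumes "conjugate_exponents p q"
  shows "1 \<le> q t"
proof -
  have "1 / q t \<le> 1"
    using assms unfolding conjugate_exponents_def by (metis add.commute le_iff_add)
  then show ?thesis
  proof (cases "q t")
    case (real r)
    have "q t \<noteq> 0"
      using \<open>1 / q t \<le> 1\<close> by (auto simp: divide_ennreal_def top_unique)
    with real have "0 < r" by auto
    then show ?thesis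
      using \<open>1 / q t \<le> 1\<close> real by (simp add: divide_ennreal flip: ennreal_1)
  qed simp
qed

lemma inv_exponent_conjugate:
  assumes "exponent_function p" "conjugate_exponents p q"
  shows "inv_exponent p t + inv_exponent q t = 1"
proof -
  have "1 / p t \<le> 1" "1 / q t \<le> 1"
    using assms conjugate_exponents_ge_one[OF assms(2)]
    by (auto intro!: one_divide_ennreal_le_one simp: exponent_function_def)
  then have "enn2real (1 / p t + 1 / q t) = inv_exponent p t + inv_exponent q t"
    unfolding inv_exponent_def by (intro enn2real_plus) (auto intro: le_less_trans)
  moreover have "1 / p t + 1 / q t = 1"
    using assms(2) by (simp add: conjugate_exponents_def)
  ultimately show ?thesis by simp
qed

lemma measurable_conjugate_exponent:
  assumes "exponent_function p" "conjugate_exponents p q"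
  shows "q \<in> borel_measurable lebesgue"
proof -
  have [measurable]: "p \<in> borel_measurable lebesgue"
    using assms(1) by (simp add: exponent_function_def)
  have "q t = 1 / (1 - 1 / p t)" for t
  proof -
    have "1 / p t \<le> 1"
      using assms(1) by (auto intro!: one_divide_ennreal_le_one simp: exponent_function_def)
    then have "1 / p t \<noteq> top" by (auto simp: top_unique)
    moreover have "1 / p t + 1 / q t = 1"
      using assms(2) by (simp add: conjugate_exponents_def)
    ultimately have "1 - 1 / p t = 1 / q t"
      by (metis ennreal_add_diff_cancel_left infinity_ennreal_def)
    then show ?thesis
      using one_divide_one_divide_ennreal[OF conjugate_exponents_ge_one[OF assms(2)], of t] by simp
  qed
  then have "q = (\<lambda>t. 1 / (1 - 1 / p t))" by auto
  then show ?thesis by simp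
qed

text \<open>
  The supremum that defines the essential infimum is the supremum of a sequence, and countably many
  null sets can be collected.
\<close>

lemma AE_essinf_le: "AE x in M. essinf M p \<le> p x"
proof -
  have "{z. AE x in M. z \<le> p x} \<noteq> {}" by (auto intro!: exI[of _ 0])
  from ennreal_Sup_countable_SUP[OF this] obtain u :: "nat \<Rightarrow> ennreal"
    where u: "range u \<subseteq> {z. AE x in M. z \<le> p x}" "essinf M p = (SUP i. u i)"
    unfolding essinf_def by auto
  have "AE x in M. \<forall>i. u i \<le> p x"
    using u(1) by (subst AE_all_countable) auto
  then show ?thesis
    unfolding u(2) by eventually_elim (auto intro: SUP_least)
qed

lemma
  assumes "exponent_function p"
  shows AE_inv_exponent_le: "AE t in lebesgue. inv_exponent p t \<le> inv_p_minus p"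
    and inv_p_minus_le_one: "inv_p_minus p \<le> 1"
proof -
  have ge1: "1 \<le> essinf lebesgue p"
    unfolding essinf_def using assms by (intro Sup_upper) (auto simp: exponent_function_def)
  then have le1: "1 / essinf lebesgue p \<le> 1"
    by (rule one_divide_ennreal_le_one)
  show "AE t in lebesgue. inv_exponent p t \<le> inv_p_minus p"
    using AE_essinf_le[of lebesgue p]
  proof eventually_elim
    fix t assume "essinf lebesgue p \<le> p t"
    with ge1 have "1 / p t \<le> 1 / essinf lebesgue p"
      by (rule one_divide_ennreal_antimono)
    then show "inv_exponent p t \<le> inv_p_minus p"
      unfolding inv_exponent_def inv_p_minus_def using le1
      by (intro enn2real_mono) (auto intro: le_less_trans)
  qed
  show "inv_p_minus p \<le> 1"
    unfolding inv_p_minus_def using enn2real_mono[OF le1] by simp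
qed

lemma AE_norm_le_of_modular:
  assumes p: "p \<in> borel_measurable lebesgue" and "modular p F \<le> ennreal c" "0 \<le> c"
  shows "AE t in lebesgue. p t = \<infinity> \<longrightarrow> norm (F t) \<le> c"
proof -
  let ?S = "{t. p t = \<infinity>}"
  have S: "?S \<inter> space lebesgue \<in> sets lebesgue"
    using measurable_sets[OF p, of "{\<infinity>}"] by (simp add: vimage_def)
  have "AE t in lebesgue_on ?S. ennreal (norm (F t)) \<le> esssup (lebesgue_on ?S) (\<lambda>t. ennreal (norm (F t)))"
    by (rule esssup_AE)
  then have "AE t in lebesgue_on ?S. norm (F t) \<le> c"
  proof eventually_elim
    fix t assume "ennreal (norm (F t)) \<le> esssup (lebesgue_on ?S) (\<lambda>t. ennreal (norm (F t)))"
    also have "\<dots> \<le> modular p F" unfolding modular_def by simp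
    also have "\<dots> \<le> ennreal c" by fact
    finally show "norm (F t) \<le> c" using \<open>0 \<le> c\<close> by simp
  qed
  then show ?thesis
    by (subst (asm) AE_restrict_space_iff[OF S]) simp
qed

text \<open>
  Bounds for a modular are proved separately where the exponent is finite, through an integrable
  majorant \<open>G\<close>, and where it is infinite, through a uniform bound \<open>B\<close>.
\<close>

lemma modular_le:
  assumes p: "p \<in> borel_measurable lebesgue" and F: "F \<in> borel_measurable lebesgue"
    and fin: "AE t in lebesgue. p t \<noteq> \<infinity> \<longrightarrow> ennreal (norm (F t) powr enn2real (p t)) \<le> G t"
    and G: "(\<integral>\<^sup>+t. G t \<partial>lebesgue) \<le> A"
    and inf: "AE t in lebesgue. p t = \<infinity> \<longrightarrow> ennreal (norm (F t)) \<le> B"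
  shows "modular p F \<le> A + B"
  unfolding modular_def
proof (rule add_mono)
  have "(\<integral>\<^sup>+t\<in>{t. p t \<noteq> \<infinity>}. ennreal (norm (F t) powr enn2real (p t)) \<partial>lebesgue) \<le> (\<integral>\<^sup>+t. G t \<partial>lebesgue)"
    using fin by (intro nn_integral_mono_AE) (auto elim!: eventually_mono simp: indicator_def)
  then show "(\<integral>\<^sup>+t\<in>{t. p t \<noteq> \<infinity>}. ennreal (norm (F t) powr enn2real (p t)) \<partial>lebesgue) \<le> A"
    using G by (rule order_trans)
  have S: "{t. p t = \<infinity>} \<inter> space lebesgue \<in> sets lebesgue"
    using measurable_sets[OF p, of "{\<infinity>}"] by (simp add: vimage_def)
  show "esssup (lebesgue_on {t. p t = \<infinity>}) (\<lambda>t. ennreal (norm (F t))) \<le> B"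
  proof (rule esssup_I)
    show "(\<lambda>t. ennreal (norm (F t))) \<in> borel_measurable (lebesgue_on {t. p t = \<infinity>})"
      using F by (intro measurable_restrict_space1) measurable
    show "AE t in lebesgue_on {t. p t = \<infinity>}. ennreal (norm (F t)) \<le> B"
      using inf by (subst AE_restrict_space_iff[OF S]) simp
  qed
qed

text \<open>
  Dividing a function by \<open>N \<ge> 1\<close> divides its modular by at least \<open>N\<close>, since all exponents are at
  least \<open>1\<close>.
\<close>

lemma Lvar_scale:
  assumes p: "exponent_function p" and f: "f \<in> Lvar p"
  obtains c where "0 < c" "modular p (\<lambda>t. f t / of_real c) \<le> 1"
proof -
  have pm: "p \<in> borel_measurable lebesgue" and p1: "\<And>t. 1 \<le> p t"
    using p by (auto simp: exponent_function_def)
  obtain d where d: "0 < d" and fin: "modular p (\<lambda>t. f t / of_real d) < \<infinity>"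
    and fm: "f \<in> borel_measurable lebesgue"
    using f by (auto simp: Lvar_def)
  let ?F = "\<lambda>t. f t / of_real d"
  obtain m where m: "modular p ?F = ennreal m" "0 \<le> m"
    using fin by (cases "modular p ?F") auto
  define N where "N = m + 1"
  have N: "1 \<le> N" "0 < N" using m(2) by (auto simp: N_def)
  let ?I = "\<integral>\<^sup>+t\<in>{t. p t \<noteq> \<infinity>}. ennreal (norm (?F t) powr enn2real (p t)) \<partial>lebesgue"
  let ?E = "esssup (lebesgue_on {t. p t = \<infinity>}) (\<lambda>t. ennreal (norm (?F t)))"
  have S: "{t. p t = \<infinity>} \<inter> space lebesgue \<in> sets lebesgue"
    using measurable_sets[OF pm, of "{\<infinity>}"] by (simp add: vimage_def)
  have "modular p (\<lambda>t. f t / of_real (d * N)) \<le> ennreal (1 / N) * ?I + ennreal (1 / N) * ?E"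
  proof (rule modular_le[OF pm])
    show "AE t in lebesgue. p t \<noteq> \<infinity> \<longrightarrow> ennreal (norm (f t / of_real (d * N)) powr enn2real (p t))
        \<le> ennreal (1 / N) * (ennreal (norm (?F t) powr enn2real (p t)) * indicator {t. p t \<noteq> \<infinity>} t)"
    proof (intro AE_I2 impI)
      fix t assume t: "p t \<noteq> \<infinity>"
      have "norm (f t / of_real (d * N)) powr enn2real (p t) = (1 / N * norm (?F t)) powr enn2real (p t)"
        using d N by (simp add: norm_divide norm_mult mult.commute)
      also have "\<dots> = (1 / N) powr enn2real (p t) * norm (?F t) powr enn2real (p t)"
        by (rule powr_mult)
      also have "\<dots> \<le> 1 / N * norm (?F t) powr enn2real (p t)"
        using N inv_exponent_eq(1)[of p t, OF p1 t] by (intro mult_right_mono powr_le_one_le) auto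
      finally show "ennreal (norm (f t / of_real (d * N)) powr enn2real (p t))
        \<le> ennreal (1 / N) * (ennreal (norm (?F t) powr enn2real (p t)) * indicator {t. p t \<noteq> \<infinity>} t)"
        using t N by (simp add: ennreal_mult'[symmetric] ennreal_leI)
    qed
    show "(\<integral>\<^sup>+t. ennreal (1 / N) * (ennreal (norm (?F t) powr enn2real (p t)) * indicator {t. p t \<noteq> \<infinity>} t) \<partial>lebesgue)
        \<le> ennreal (1 / N) * ?I"
      using pm fm by (subst nn_integral_cmult) auto
    have "AE t in lebesgue. t \<in> {t. p t = \<infinity>} \<longrightarrow> ennreal (norm (?F t)) \<le> ?E"
      by (subst AE_restrict_space_iff[OF S, symmetric]) (rule esssup_AE)
    then show "AE t in lebesgue. p t = \<infinity> \<longrightarrow> ennreal (norm (f t / of_real (d * N))) \<le> ennreal (1 / N) * ?E"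
    proof eventually_elim
      fix t assume "t \<in> {t. p t = \<infinity>} \<longrightarrow> ennreal (norm (?F t)) \<le> ?E"
      then have "ennreal (1 / N) * ennreal (norm (?F t)) \<le> ennreal (1 / N) * ?E" if "p t = \<infinity>"
        using that by (intro mult_left_mono) auto
      moreover have "ennreal (norm (f t / of_real (d * N))) = ennreal (1 / N) * ennreal (norm (?F t))"
        using d N by (simp add: norm_divide norm_mult ennreal_mult'[symmetric])
      ultimately show "p t = \<infinity> \<longrightarrow> ennreal (norm (f t / of_real (d * N))) \<le> ennreal (1 / N) * ?E"
        by simp
    qed
  qed (use fm in measurable)
  also have "\<dots> = ennreal (1 / N) * modular p ?F"
    by (simp add: modular_def distrib_left)
  also have "\<dots> = ennreal (m / N)"
    using m N by (simp add: ennreal_mult'[symmetric])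
  also have "\<dots> \<le> 1"
    using N by (simp add: N_def)
  finally show ?thesis using d N by (intro that[of "d * N"]) auto
qed

text \<open>
  If one of the exponents is infinite, then the other one is \<open>1\<close>, and the product is at most the factor
  that belongs to the finite exponent.
\<close>

lemma Young_variable_exponent:
  assumes pq: "exponent_function p" "conjugate_exponents p q" and "0 \<le> a" "0 \<le> b"
    and "p t = \<infinity> \<Longrightarrow> a \<le> 1" "q t = \<infinity> \<Longrightarrow> b \<le> 1"
  shows "a * b \<le> (if p t = \<infinity> then 0 else a powr enn2real (p t)) + (if q t = \<infinity> then 0 else b powr enn2real (q t))"
proof -
  have p1: "1 \<le> p t" using pq(1) by (simp add: exponent_function_def)
  have q1: "1 \<le> q t" by (rule conjugate_exponents_ge_one) fact
  note sum = inv_exponent_conjugate[OF pq, of t]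
  consider "p t = \<infinity>" | "q t = \<infinity>" "p t \<noteq> \<infinity>" | "p t \<noteq> \<infinity>" "q t \<noteq> \<infinity>" by blast
  then show ?thesis
  proof cases
    case 1
    then have "inv_exponent q t = 1" using sum inv_exponent_infinity[of p t] by simp
    moreover from this have "q t \<noteq> \<infinity>" using inv_exponent_infinity[of q t] by auto
    ultimately have "enn2real (q t) = 1" using inv_exponent_eq[of q t, OF q1] by simp
    then show ?thesis
      using 1 assms(3-5) \<open>q t \<noteq> \<infinity>\<close> by (simp add: mult_left_le_one_le)
  next
    case 2
    then have "inv_exponent p t = 1" using sum inv_exponent_infinity[of q t] by simp
    then have "enn2real (p t) = 1" using inv_exponent_eq[of p t, OF p1 2(2)] by simp
    then show ?thesis
      using 2 assms(3,4,6) by (simp add: mult_left_le)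
  next
    case 3
    let ?P = "enn2real (p t)" and ?Q = "enn2real (q t)"
    note P = inv_exponent_eq[of p t, OF p1 3(1)] and Q = inv_exponent_eq[of q t, OF q1 3(2)]
    have eq: "1 / ?P + 1 / ?Q = 1" using sum P(2) Q(2) by simp
    moreover have "0 < 1 / ?P" "0 < 1 / ?Q" using P(1) Q(1) by auto
    ultimately have "1 / ?P < 1" "1 / ?Q < 1" by linarith+
    then have "1 < ?P" "1 < ?Q" using P(1) Q(1) by (auto simp: divide_less_eq)
    from Youngs_inequality[OF this eq assms(3,4)]
    have "a * b \<le> a powr ?P / ?P + b powr ?Q / ?Q" .
    also have "\<dots> \<le> a powr ?P / 1 + b powr ?Q / 1"
      using P(1) Q(1) by (intro add_mono divide_left_mono) auto
    finally show ?thesis using 3 by simp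
  qed
qed

text \<open>
  Young's inequality is integrated pointwise.  Each of the two modulars contributes at most \<open>1\<close>.
\<close>

lemma Hoelder_variable_exponent:
  assumes pq: "exponent_function p" "conjugate_exponents p q"
    and F: "F \<in> borel_measurable lebesgue" "modular p F \<le> 1"
    and H: "H \<in> borel_measurable lebesgue" "modular q H \<le> 1"
  shows "(\<integral>\<^sup>+t. ennreal (norm (H t) * norm (F t)) \<partial>lebesgue) \<le> 2"
proof -
  note [measurable] = F(1) H(1) measurable_conjugate_exponent[OF pq]
  have pm [measurable]: "p \<in> borel_measurable lebesgue"
    using pq(1) by (simp add: exponent_function_def)
  have "AE t in lebesgue. p t = \<infinity> \<longrightarrow> norm (F t) \<le> 1" "AE t in lebesgue. q t = \<infinity> \<longrightarrow> norm (H t) \<le> 1"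
    using AE_norm_le_of_modular[OF pm, of F 1] AE_norm_le_of_modular[of q H 1] F(2) H(2) by auto
  then have "(\<integral>\<^sup>+t. ennreal (norm (H t) * norm (F t)) \<partial>lebesgue) \<le>
      (\<integral>\<^sup>+t. ennreal (norm (F t) powr enn2real (p t)) * indicator {t. p t \<noteq> \<infinity>} t +
        ennreal (norm (H t) powr enn2real (q t)) * indicator {t. q t \<noteq> \<infinity>} t \<partial>lebesgue)"
  proof (intro nn_integral_mono_AE, eventually_elim)
    fix t assume "p t = \<infinity> \<longrightarrow> norm (F t) \<le> 1" "q t = \<infinity> \<longrightarrow> norm (H t) \<le> 1"
    then have "norm (F t) * norm (H t) \<le> (if p t = \<infinity> then 0 else norm (F t) powr enn2real (p t)) +
        (if q t = \<infinity> then 0 else norm (H t) powr enn2real (q t))"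
      by (intro Young_variable_exponent pq) auto
    moreover have "p t \<noteq> \<infinity> \<or> q t \<noteq> \<infinity>"
      using inv_exponent_conjugate[OF pq, of t] inv_exponent_infinity[of p t] inv_exponent_infinity[of q t] by auto
    moreover note ennreal_leI[OF calculation(1)]
    ultimately show "ennreal (norm (H t) * norm (F t)) \<le>
        ennreal (norm (F t) powr enn2real (p t)) * indicator {t. p t \<noteq> \<infinity>} t +
        ennreal (norm (H t) powr enn2real (q t)) * indicator {t. q t \<noteq> \<infinity>} t"
      by (auto simp: indicator_def mult.commute simp flip: ennreal_plus)
  qed
  also have "\<dots> = (\<integral>\<^sup>+t\<in>{t. p t \<noteq> \<infinity>}. ennreal (norm (F t) powr enn2real (p t)) \<partial>lebesgue) +
      (\<integral>\<^sup>+t\<in>{t. q t \<noteq> \<infinity>}. ennreal (norm (H t) powr enn2real (q t)) \<partial>lebesgue)"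
    by (intro nn_integral_add) measurable
  also have "\<dots> \<le> modular p F + modular q H"
    unfolding modular_def by (intro add_mono) auto
  also have "\<dots> \<le> 1 + 1" using F(2) H(2) by (rule add_mono)
  finally show ?thesis by simp
qed

section \<open>The norm of the kernel in the conjugate space\<close>

lemma nn_integral_decay_finite:
  assumes "1 < \<rho>"
  obtains D where "0 \<le> D" "(\<integral>\<^sup>+u. ennreal ((1 + \<bar>u\<bar>) powr - \<rho>) \<partial>lborel) \<le> ennreal D"
proof -
  let ?h = "\<lambda>u. ennreal (u powr - \<rho>) * indicator {1..} u"
  define c where "c = - (1 powr (- \<rho> + 1)) / (- \<rho> + 1)"
  have c: "0 \<le> c" using assms by (simp add: c_def divide_nonneg_neg divide_nonpos_neg)
  have tail: "(\<integral>\<^sup>+u. ?h u \<partial>lborel) = ennreal c"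
    unfolding c_def using assms
    by (intro nn_integral_has_integral_lebesgue' has_integral_powr_to_inf) auto
  have refl: "(\<integral>\<^sup>+u. ?h (- u) \<partial>lborel) = ennreal c"
    using nn_integral_real_affine[of ?h "-1" 0] tail by simp
  have "(\<integral>\<^sup>+u. ennreal ((1 + \<bar>u\<bar>) powr - \<rho>) \<partial>lborel)
      \<le> (\<integral>\<^sup>+u. indicator {- 1..1} u + (?h u + ?h (- u)) \<partial>lborel)"
  proof (rule nn_integral_mono)
    fix u :: real
    consider "\<bar>u\<bar> \<le> 1" | "1 < u" | "u < - 1" by linarith
    then show "ennreal ((1 + \<bar>u\<bar>) powr - \<rho>) \<le> indicator {- 1..1} u + (?h u + ?h (- u))"
    proof cases
      case 1
      have "(1 + \<bar>u\<bar>) powr - \<rho> \<le> (1 + \<bar>u\<bar>) powr 0"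
        using assms by (intro powr_mono) auto
      then have "ennreal ((1 + \<bar>u\<bar>) powr - \<rho>) \<le> 1" by (simp split: if_splits)
      also have "\<dots> \<le> indicator {- 1..1} u + (?h u + ?h (- u))"
        using 1 by (intro add_increasing2) (auto simp: abs_le_iff)
      finally show ?thesis .
    next
      case 2
      have "(1 + \<bar>u\<bar>) powr - \<rho> \<le> u powr - \<rho>"
        using assms 2 by (intro powr_mono2') auto
      with 2 show ?thesis by (simp add: ennreal_leI)
    next
      case 3
      have "(1 + \<bar>u\<bar>) powr - \<rho> \<le> (- u) powr - \<rho>"
        using assms 3 by (intro powr_mono2') auto
      with 3 show ?thesis by (simp add: ennreal_leI)
    qed
  qed
  also have "\<dots> = emeasure lborel {- 1..1::real} + (ennreal c + ennreal c)"
    by (subst nn_integral_add, simp, simp)+ (simp add: tail refl)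
  also have "\<dots> = ennreal (2 + (c + c))"
  proof -
    have "emeasure lborel {- 1..1::real} = ennreal 2" by (simp add: emeasure_lborel_Icc_eq)
    then show ?thesis using c by (metis ennreal_plus add_nonneg_nonneg zero_le_numeral)
  qed
  finally show ?thesis using c by (intro that[of "2 + (c + c)"]) auto
qed

lemma nn_integral_decay_scale:
  assumes "s \<noteq> 0"
  shows "(\<integral>\<^sup>+t. ennreal (\<bar>s\<bar> * (1 + \<bar>s * t\<bar>) powr - \<rho>) \<partial>lborel) = (\<integral>\<^sup>+u. ennreal ((1 + \<bar>u\<bar>) powr - \<rho>) \<partial>lborel)"
  using nn_integral_real_affine[of "\<lambda>u. ennreal ((1 + \<bar>u\<bar>) powr - \<rho>)" s 0] assms
  by (simp add: ennreal_mult' nn_integral_cmult)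

text \<open>
  This form of the bound scales with \<open>s\<close>: up to the factor \<open>\<bar>s\<bar>\<close> it is a function of \<open>s t\<close>.
\<close>

lemma kbound_le_decay: "kbound s t \<le> 3 * \<bar>s\<bar> * (1 + \<bar>s * t\<bar>) powr - 1"
proof -
  have "kbound s t * (1 + \<bar>s * t\<bar>) \<le> 3 * \<bar>s\<bar>"
  proof (cases "t = 0")
    case False
    have "kbound s t * (1 + \<bar>s * t\<bar>) = kbound s t + kbound s t * \<bar>t\<bar> * \<bar>s\<bar>"
      by (simp add: abs_mult algebra_simps)
    also have "\<dots> \<le> \<bar>s\<bar> + (2 / \<bar>t\<bar>) * \<bar>t\<bar> * \<bar>s\<bar>"
      by (intro add_mono mult_right_mono) (auto simp: kbound_def)
    finally show ?thesis using False by simp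
  qed (simp add: kbound_def)
  then have "kbound s t \<le> 3 * \<bar>s\<bar> / (1 + \<bar>s * t\<bar>)"
    by (simp add: pos_le_divide_eq)
  then show ?thesis by (simp add: powr_minus_divide)
qed

text \<open>
  The order of growth in \<open>s\<close> of the norm of \<open>h\<^sub>s\<close> in \<open>L\<^bsup>q(\<cdot>)\<^esup>\<close>.  If \<open>r\<close> is an upper bound of the exponent
  \<open>p\<close> and \<open>m = 1 / p\<^sub>-\<close>, this is the larger one of \<open>\<bar>s\<bar>\<^bsup>1/r\<^esup>\<close> and \<open>\<bar>s\<bar>\<^bsup>m\<^esup>\<close>.
\<close>

definition weight :: "real \<Rightarrow> real \<Rightarrow> real \<Rightarrow> real" where
  "weight r m s = \<bar>s\<bar> powr (if \<bar>s\<bar> \<le> 1 then 1 / r else m)"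

lemma weight_nonneg [simp]: "0 \<le> weight r m s"
  and weight_pos: "s \<noteq> 0 \<Longrightarrow> 0 < weight r m s"
  and weight_0 [simp]: "weight r m 0 = 0"
  by (auto simp: weight_def)

lemma measurable_weight [measurable]: "weight r m \<in> borel_measurable borel"
  unfolding weight_def by measurable

lemma weight_tendsto_0:
  assumes "0 < r" shows "(weight r m \<longlongrightarrow> 0) (at_right 0)"
proof -
  have "((\<lambda>s::real. \<bar>s\<bar> powr (1 / r)) \<longlongrightarrow> 0) (at_right 0)"
    using assms by (auto intro!: tendsto_eq_intros)
  moreover have "\<forall>\<^sub>F s in at_right 0. \<bar>s\<bar> powr (1 / r) = weight r m s"
    by (auto simp: eventually_at_right_field weight_def intro!: exI[of _ 1])
  ultimately show ?thesis by (rule Lim_transform_eventually)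
qed

lemma abs_div_weight: "s \<noteq> 0 \<Longrightarrow> \<bar>s\<bar> / weight r m s = \<bar>s\<bar> powr (1 - (if \<bar>s\<bar> \<le> 1 then 1 / r else m))"
  by (simp add: weight_def powr_diff)

text \<open>
  The case of a bounded exponent \<open>p \<le> r\<close>.  Write \<open>\<bar>s\<bar>\<^sup>e\<close> for the weight.  Then \<open>h\<^sub>s(t)\<close> divided by \<open>C\<close>
  times the weight is at most \<open>(3 / C) \<bar>s\<bar>\<^bsup>1-e\<^esup> / (1 + \<bar>s t\<bar>)\<close>.  The exponent \<open>e\<close> is chosen such that
  \<open>(1 - e) q(t) \<ge> 1\<close> for \<open>\<bar>s\<bar> \<le> 1\<close> and \<open>(1 - e) q(t) \<le> 1\<close> for \<open>\<bar>s\<bar> > 1\<close>, if \<open>q(t)\<close> is finite.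
  In both cases the power \<open>q(t)\<close> of this bound is at most \<open>(3 / C) \<bar>s\<bar> (1 + \<bar>s t\<bar>)\<^bsup>-\<rho>\<^esup>\<close>.  Here \<open>\<rho> > 1\<close> is the exponent conjugate
  to \<open>r\<close>, a lower bound of \<open>q\<close>.  The integral over \<open>t\<close> does not depend on \<open>s\<close>.
\<close>

lemma modular_kbound_le_of_exponent_bounds:
  assumes pq: "exponent_function p" "conjugate_exponents p q"
    and le: "AE t in lebesgue. 1 / r \<le> inv_exponent p t \<and> inv_exponent p t \<le> m"
    and "1 < r" "m \<le> 1"
  obtains C where "0 < C"
    "\<And>s. s \<noteq> 0 \<Longrightarrow> modular q (\<lambda>t. of_real (kbound s t / (C * weight r m s))) \<le> 1"
proof -
  define \<rho> where "\<rho> = 1 / (1 - 1 / r)"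
  have \<rho>: "1 < \<rho>" using \<open>1 < r\<close> by (simp add: \<rho>_def less_divide_eq)
  obtain D where D: "0 \<le> D" "(\<integral>\<^sup>+u. ennreal ((1 + \<bar>u\<bar>) powr - \<rho>) \<partial>lborel) \<le> ennreal D"
    using nn_integral_decay_finite[OF \<rho>] .
  \<comment> \<open>The finite exponents contribute \<open>3 D / C\<close> and the infinite ones \<open>3 / C\<close> to the modular.\<close>
  define C where "C = 3 * (D + 1)"
  have "3 / C * D + 3 / C = 3 * (D + 1) / C"
    by (simp add: add_divide_distrib)
  moreover have "C \<noteq> 0" using D(1) by (simp add: C_def)
  ultimately have C: "3 \<le> C" "0 < C" "3 / C \<le> 1" "3 / C * D + 3 / C = 1"
    using D(1) by (auto simp: C_def)
  show ?thesis
  proof (rule that[OF C(2)])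
    fix s :: real assume s: "s \<noteq> 0"
    let ?w = "weight r m s" and ?e = "if \<bar>s\<bar> \<le> 1 then 1 / r else m"
    let ?X = "\<lambda>t. complex_of_real (kbound s t / (C * ?w))"
    note w = weight_pos[OF s, of r m]
    have norm_X: "norm (?X t) = kbound s t / (C * ?w)" for t
      using C(2) w by (simp add: norm_divide norm_mult)
    have X_le: "norm (?X t) \<le> (3 / C) * \<bar>s\<bar> powr (1 - ?e) * (1 + \<bar>s * t\<bar>) powr - 1" for t
    proof -
      have "norm (?X t) \<le> 3 * \<bar>s\<bar> * (1 + \<bar>s * t\<bar>) powr - 1 / (C * ?w)"
        unfolding norm_X using C(2) w by (intro divide_right_mono kbound_le_decay) auto
      also have "\<dots> = (3 / C) * (\<bar>s\<bar> / ?w) * (1 + \<bar>s * t\<bar>) powr - 1" by simp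
      finally show ?thesis unfolding abs_div_weight[OF s] .
    qed
    have "modular q ?X \<le> ennreal (3 / C * D) + ennreal (3 / C)"
    proof (rule modular_le[OF measurable_conjugate_exponent[OF pq]])
      show "?X \<in> borel_measurable lebesgue"
        using measurable_lebesgue_kbound[of s] by measurable
      show "AE t in lebesgue. q t \<noteq> \<infinity> \<longrightarrow> ennreal (norm (?X t) powr enn2real (q t))
          \<le> ennreal (3 / C * (\<bar>s\<bar> * (1 + \<bar>s * t\<bar>) powr - \<rho>))"
        using le
      proof (eventually_elim, intro impI ennreal_leI)
        fix t assume pt: "1 / r \<le> inv_exponent p t \<and> inv_exponent p t \<le> m" and qt: "q t \<noteq> \<infinity>"
        define Q where "Q = enn2real (q t)"
        have Q: "1 \<le> Q" "1 / Q = 1 - inv_exponent p t"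
          using inv_exponent_eq[of q t, OF conjugate_exponents_ge_one[OF pq(2)] qt]
            inv_exponent_conjugate[OF pq, of t] by (auto simp: Q_def)
        have r: "1 / Q \<le> 1 - 1 / r" "0 < 1 - 1 / r" and m: "1 - m \<le> 1 / Q"
          using pt Q(2) \<open>1 < r\<close> by auto
        have rQ: "1 \<le> (1 - 1 / r) * Q" and mQ: "(1 - m) * Q \<le> 1" and \<rho>Q: "\<rho> \<le> Q"
          using r m Q(1) unfolding \<rho>_def by (auto simp: field_simps)
        have "norm (?X t) powr Q \<le> ((3 / C) * \<bar>s\<bar> powr (1 - ?e) * (1 + \<bar>s * t\<bar>) powr - 1) powr Q"
          using X_le Q(1) by (intro powr_mono2) auto
        also have "\<dots> = (3 / C) powr Q * \<bar>s\<bar> powr ((1 - ?e) * Q) * (1 + \<bar>s * t\<bar>) powr - Q"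
          by (simp only: powr_mult powr_powr mult_minus_left mult_1)
        also have "\<dots> \<le> 3 / C * \<bar>s\<bar> * (1 + \<bar>s * t\<bar>) powr - \<rho>"
        proof (intro mult_mono)
          show "(3 / C) powr Q \<le> 3 / C"
            using C Q(1) by (intro powr_le_one_le) auto
          show "\<bar>s\<bar> powr ((1 - ?e) * Q) \<le> \<bar>s\<bar>"
          proof (cases "\<bar>s\<bar> \<le> 1")
            case True
            then show ?thesis using powr_mono'[OF rQ, of "\<bar>s\<bar>"] by simp
          next
            case False
            then show ?thesis using powr_mono[OF mQ, of "\<bar>s\<bar>"] by simp
          qed
          show "(1 + \<bar>s * t\<bar>) powr - Q \<le> (1 + \<bar>s * t\<bar>) powr - \<rho>"
            using \<rho>Q by (intro powr_mono) auto
        qed (use C in auto)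
        finally show "norm (?X t) powr enn2real (q t) \<le> 3 / C * (\<bar>s\<bar> * (1 + \<bar>s * t\<bar>) powr - \<rho>)"
          by (simp add: Q_def mult.assoc)
      qed
      have "(\<integral>\<^sup>+t. ennreal (3 / C * (\<bar>s\<bar> * (1 + \<bar>s * t\<bar>) powr - \<rho>)) \<partial>lebesgue) =
          ennreal (3 / C) * (\<integral>\<^sup>+t. ennreal (\<bar>s\<bar> * (1 + \<bar>s * t\<bar>) powr - \<rho>) \<partial>lborel)"
        unfolding nn_integral_completion using C(2)
        by (subst nn_integral_cmult[symmetric]) (auto simp: ennreal_mult'[symmetric])
      also have "\<dots> \<le> ennreal (3 / C) * ennreal D"
        unfolding nn_integral_decay_scale[OF s] by (intro mult_left_mono D(2)) simp
      finally show "(\<integral>\<^sup>+t. ennreal (3 / C * (\<bar>s\<bar> * (1 + \<bar>s * t\<bar>) powr - \<rho>)) \<partial>lebesgue) \<le> ennreal (3 / C * D)"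
        using C(2) D(1) by (simp add: ennreal_mult del: times_divide_eq_left)
      show "AE t in lebesgue. q t = \<infinity> \<longrightarrow> ennreal (norm (?X t)) \<le> ennreal (3 / C)"
        using le
      proof (eventually_elim, intro impI ennreal_leI)
        fix t assume pt: "1 / r \<le> inv_exponent p t \<and> inv_exponent p t \<le> m" and qt: "q t = \<infinity>"
        \<comment> \<open>An infinite \<open>q(t)\<close> means \<open>p(t) = 1\<close>, which forces \<open>m = 1\<close>: for \<open>\<bar>s\<bar> > 1\<close> the power of \<open>\<bar>s\<bar>\<close>
           disappears, and for \<open>\<bar>s\<bar> \<le> 1\<close> its exponent is nonnegative.\<close>
        have "1 \<le> m"
          using pt inv_exponent_conjugate[OF pq, of t] inv_exponent_infinity[of q t, OF qt] by simp
        then have "m = 1" using \<open>m \<le> 1\<close> by simp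
        then have "\<bar>s\<bar> powr (1 - ?e) \<le> 1"
          using \<open>1 < r\<close> by (auto intro: powr_le1)
        moreover have "(1 + \<bar>s * t\<bar>) powr - 1 \<le> (1 + \<bar>s * t\<bar>) powr 0"
          by (intro powr_mono) auto
        then have "(1 + \<bar>s * t\<bar>) powr - 1 \<le> 1" by simp
        ultimately have "(3 / C) * \<bar>s\<bar> powr (1 - ?e) * (1 + \<bar>s * t\<bar>) powr - 1 \<le> 3 / C * 1 * 1"
          using C by (intro mult_mono) auto
        with X_le[of t] show "norm (?X t) \<le> 3 / C" by simp
      qed
    qed
    also have "\<dots> = 1"
      using C D(1) by (simp flip: ennreal_plus)
    finally show "modular q ?X \<le> 1" .
  qed
qed

text \<open>
  Far away from \<open>0\<close> the values \<open>1 / p(t)\<close> are arbitrarily close to \<open>1\<close> on sets of positive measure, so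
  their essential supremum \<open>1 / p\<^sub>-\<close> is \<open>1\<close>.
\<close>

lemma inv_p_minus_eq_one_of_log_Hoelder:
  assumes p: "exponent_function p" and lH: "log_Hoelder_at_infinity p 1"
  shows "inv_p_minus p = 1"
proof -
  obtain c where c: "0 < c" "AE t in lebesgue. \<bar>inv_exponent p t - 1\<bar> \<le> c / ln (exp 1 + \<bar>t\<bar>)"
    using lH unfolding log_Hoelder_at_infinity_def inv_exponent_def by blast
  have AE: "AE t in lebesgue. 1 - c / ln (exp 1 + \<bar>t\<bar>) \<le> inv_p_minus p"
    using c(2) AE_inv_exponent_le[OF p] by eventually_elim linarith
  have "1 - 1 / real (Suc n) \<le> inv_p_minus p" for n
  proof (rule ccontr)
    assume neg: "\<not> 1 - 1 / real (Suc n) \<le> inv_p_minus p"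
    \<comment> \<open>From \<open>T\<close> on the logarithm is at least \<open>c (n + 1)\<close>.\<close>
    define T where "T = exp (c * real (Suc n))"
    have "AE t in lborel. t \<notin> {T..T + 1}"
      using AE unfolding AE_completion_iff
    proof eventually_elim
      fix t assume t: "1 - c / ln (exp 1 + \<bar>t\<bar>) \<le> inv_p_minus p"
      show "t \<notin> {T..T + 1}"
      proof
        assume "t \<in> {T..T + 1}"
        then have "T \<le> exp 1 + \<bar>t\<bar>" by (auto intro: add_increasing)
        then have "c * real (Suc n) \<le> ln (exp 1 + \<bar>t\<bar>)"
          unfolding T_def by (subst ln_ge_iff) (auto intro: add_pos_nonneg)
        moreover from this have "0 < ln (exp 1 + \<bar>t\<bar>)"
          by (rule less_le_trans[rotated]) (use c(1) in simp)
        ultimately have "c / ln (exp 1 + \<bar>t\<bar>) \<le> c / (c * real (Suc n))"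
          using c(1) by (intro divide_left_mono mult_pos_pos) auto
        also have "\<dots> = 1 / real (Suc n)" using c(1) by simp
        finally show False using t neg by linarith
      qed
    qed
    then have "emeasure lborel {T..T + 1} = 0"
      by (subst (asm) AE_iff_measurable[where N = "{T..T + 1}"]) auto
    then show False by (simp add: emeasure_lborel_Icc_eq)
  qed
  moreover have "(\<lambda>n. 1 - 1 / real (Suc n)) \<longlonglongrightarrow> 1 - 0"
    by (intro tendsto_intros LIMSEQ_Suc lim_1_over_n)
  ultimately have "1 \<le> inv_p_minus p"
    by (intro LIMSEQ_le_const2[where X = "\<lambda>n. 1 - 1 / real (Suc n)"]) auto
  then show ?thesis using inv_p_minus_le_one[OF p] by simp
qed

text \<open>
  Here \<open>1 / q(t) \<le> c / log (e + \<bar>t\<bar>)\<close>, so that \<open>exp (- 2 c q(t)) \<le> (e + \<bar>t\<bar>)\<^bsup>-2\<^esup>\<close>: the modular of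
  the constant \<open>exp (- 2 c)\<close> is finite.  As \<open>h\<^sub>s \<le> \<bar>s\<bar>\<close>, the weight \<open>\<bar>s\<bar>\<close> works for all \<open>s\<close>.
\<close>

lemma modular_kbound_le_of_log_Hoelder:
  assumes pq: "exponent_function p" "conjugate_exponents p q" and lH: "log_Hoelder_at_infinity p 1"
  obtains C where "0 < C"
    "\<And>s. s \<noteq> 0 \<Longrightarrow> modular q (\<lambda>t. of_real (kbound s t / (C * weight 1 1 s))) \<le> 1"
proof -
  obtain c where c: "0 < c" "AE t in lebesgue. \<bar>inv_exponent p t - 1\<bar> \<le> c / ln (exp 1 + \<bar>t\<bar>)"
    using lH unfolding log_Hoelder_at_infinity_def inv_exponent_def by blast
  obtain D where D: "0 \<le> D" "(\<integral>\<^sup>+u. ennreal ((1 + \<bar>u\<bar>) powr - 2) \<partial>lborel) \<le> ennreal D"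
    using nn_integral_decay_finite[of 2] by auto
  define B where "B = D + 1"
  define C where "C = B * exp (2 * c)"
  have "1 / B * D + 1 / B = (D + 1) / B"
    by (simp add: add_divide_distrib)
  then have B: "1 \<le> B" "0 < B" "1 / B * D + 1 / B = 1"
    using D(1) by (auto simp: B_def)
  have C: "0 < C" using B by (simp add: C_def)
  show ?thesis
  proof (rule that[OF C])
    fix s :: real assume s: "s \<noteq> 0"
    let ?X = "\<lambda>t. complex_of_real (kbound s t / (C * weight 1 1 s))"
    have X_le: "norm (?X t) \<le> 1 / B * exp (- (2 * c))" for t
    proof -
      have "norm (?X t) = kbound s t / \<bar>s\<bar> * (1 / C)"
        using C s by (simp add: weight_def norm_divide norm_mult)
      also have "\<dots> \<le> 1 * (1 / C)"
        using C s by (intro mult_right_mono) (auto simp: kbound_def divide_le_eq)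
      finally show ?thesis by (simp add: C_def exp_minus divide_inverse)
    qed
    have "modular q ?X \<le> ennreal (1 / B * D) + ennreal (1 / B)"
    proof (rule modular_le[OF measurable_conjugate_exponent[OF pq]])
      show "?X \<in> borel_measurable lebesgue"
        using measurable_lebesgue_kbound[of s] by measurable
      show "AE t in lebesgue. q t \<noteq> \<infinity> \<longrightarrow> ennreal (norm (?X t) powr enn2real (q t))
          \<le> ennreal (1 / B * (1 + \<bar>t\<bar>) powr - 2)"
        using c(2)
      proof (eventually_elim, intro impI ennreal_leI)
        fix t assume pt: "\<bar>inv_exponent p t - 1\<bar> \<le> c / ln (exp 1 + \<bar>t\<bar>)" and qt: "q t \<noteq> \<infinity>"
        define Q where "Q = enn2real (q t)"
        let ?l = "ln (exp 1 + \<bar>t\<bar>)"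
        have l: "1 \<le> ?l" by (subst ln_ge_iff) (auto intro: add_pos_nonneg)
        have Q: "1 \<le> Q" "1 / Q = 1 - inv_exponent p t"
          using inv_exponent_eq[of q t, OF conjugate_exponents_ge_one[OF pq(2)] qt]
            inv_exponent_conjugate[OF pq, of t] by (auto simp: Q_def)
        then have "1 / Q \<le> c / ?l" using pt by linarith
        then have cQ: "?l \<le> c * Q" using Q(1) l by (simp add: field_simps)
        have "norm (?X t) powr Q \<le> (1 / B * exp (- (2 * c))) powr Q"
          using X_le Q(1) by (intro powr_mono2) auto
        also have "\<dots> = (1 / B) powr Q * exp (- 2 * (c * Q))"
          unfolding powr_mult by (simp add: powr_def[of "exp _"] mult_ac)
        also have "\<dots> \<le> 1 / B * exp (- 2 * ?l)"
          using B Q(1) cQ by (intro mult_mono powr_le_one_le) auto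
        also have "exp (- 2 * ?l) = (exp 1 + \<bar>t\<bar>) powr - 2"
          using add_pos_nonneg[OF exp_gt_zero abs_ge_zero, of 1 t] by (simp add: powr_def)
        also have "\<dots> \<le> (1 + \<bar>t\<bar>) powr - 2"
          by (intro powr_mono2') auto
        finally show "norm (?X t) powr enn2real (q t) \<le> 1 / B * (1 + \<bar>t\<bar>) powr - 2"
          using B by (simp add: Q_def divide_right_mono)
      qed
      have "(\<integral>\<^sup>+t. ennreal (1 / B * (1 + \<bar>t\<bar>) powr - 2) \<partial>lebesgue) =
          ennreal (1 / B) * (\<integral>\<^sup>+t. ennreal ((1 + \<bar>t\<bar>) powr - 2) \<partial>lborel)"
        using B by (subst nn_integral_cmult[symmetric]) (auto simp: nn_integral_completion ennreal_mult'[symmetric])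
      also have "\<dots> \<le> ennreal (1 / B) * ennreal D"
        by (intro mult_left_mono D(2)) simp
      finally show "(\<integral>\<^sup>+t. ennreal (1 / B * (1 + \<bar>t\<bar>) powr - 2) \<partial>lebesgue) \<le> ennreal (1 / B * D)"
        using B D(1) by (simp add: ennreal_mult del: times_divide_eq_left)
      have "exp (- (2 * c)) \<le> 1" using c(1) by simp
      then have "1 / B * exp (- (2 * c)) \<le> 1 / B * 1"
        using B by (intro mult_left_mono) auto
      then show "AE t in lebesgue. q t = \<infinity> \<longrightarrow> ennreal (norm (?X t)) \<le> ennreal (1 / B)"
        using X_le by (intro AE_I2 impI ennreal_leI) (metis mult.right_neutral order_trans)
    qed
    also have "\<dots> = 1"
      using B D(1) by (simp flip: ennreal_plus)
    finally show "modular q ?X \<le> 1" .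
  qed
qed

lemma AE_inv_exponent_ge_of_esssup_finite:
  assumes p: "exponent_function p" and fin: "esssup lebesgue p < \<infinity>"
  obtains r where "1 < r" "AE t in lebesgue. 1 / r \<le> inv_exponent p t"
proof -
  obtain P where P: "esssup lebesgue p = ennreal P" "0 \<le> P"
    using fin by (cases "esssup lebesgue p") auto
  have "AE t in lebesgue. 1 / (P + 2) \<le> inv_exponent p t"
    using esssup_AE[of p lebesgue]
  proof eventually_elim
    fix t assume le: "p t \<le> esssup lebesgue p"
    have p1: "1 \<le> p t" using p by (simp add: exponent_function_def)
    have fin: "p t \<noteq> \<infinity>" using le P(1) by (auto simp: top_unique)
    have "enn2real (p t) \<le> P"
      using enn2real_mono[OF le] P by simp
    then show "1 / (P + 2) \<le> inv_exponent p t"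
      using inv_exponent_eq[of p t, OF p1 fin] P(2) by (simp add: frac_le)
  qed
  then show ?thesis using P(2) by (intro that[of "P + 2"]) auto
qed

lemma modular_kbound_le:
  assumes pq: "exponent_function p" "conjugate_exponents p q"
    and "esssup lebesgue p < \<infinity> \<or> log_Hoelder_at_infinity p 1"
  obtains C r where "0 < C" "1 \<le> r"
    "\<And>s. s \<noteq> 0 \<Longrightarrow> modular q (\<lambda>t. of_real (kbound s t / (C * weight r (inv_p_minus p) s))) \<le> 1"
  using assms(3)
proof
  assume "esssup lebesgue p < \<infinity>"
  from AE_inv_exponent_ge_of_esssup_finite[OF pq(1) this] obtain r
    where r: "1 < r" "AE t in lebesgue. 1 / r \<le> inv_exponent p t" .
  have "AE t in lebesgue. 1 / r \<le> inv_exponent p t \<and> inv_exponent p t \<le> inv_p_minus p"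
    using r(2) AE_inv_exponent_le[OF pq(1)] by eventually_elim simp
  from modular_kbound_le_of_exponent_bounds[OF pq this r(1) inv_p_minus_le_one[OF pq(1)]]
  show ?thesis using that r(1) by (metis less_imp_le)
next
  assume lH: "log_Hoelder_at_infinity p 1"
  from modular_kbound_le_of_log_Hoelder[OF pq this] show ?thesis
    using that[of _ 1] inv_p_minus_eq_one_of_log_Hoelder[OF pq(1) lH] by (metis order_refl)
qed

section \<open>Minkowski's inequality and the decay at infinity\<close>

text \<open>
  Jensen's inequality for a measure of mass at most \<open>1\<close>.  Integrate the tangent inequality
  \<open>y\<^sup>Q \<ge> Q b\<^bsup>Q-1\<^esup> y - (Q - 1) b\<^sup>Q\<close>; missing mass only helps, since the constant term is not positive.
\<close>

lemma powr_le_nn_integral_powr: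
  assumes N: "emeasure N (space N) \<le> 1" and [measurable]: "k \<in> borel_measurable N"
    and k: "\<And>x. 0 \<le> k x" and Q: "1 \<le> Q" and b: "0 \<le> b" "ennreal b \<le> (\<integral>\<^sup>+x. ennreal (k x) \<partial>N)"
  shows "ennreal (b powr Q) \<le> (\<integral>\<^sup>+x. ennreal (k x powr Q) \<partial>N)"
proof (cases "b = 0")
  case False
  with b have "0 < b" by simp
  let ?c = "Q * b powr (Q - 1)" and ?d = "(Q - 1) * b powr Q"
  have pow: "b powr (Q - 1) * b = b powr Q"
    using \<open>0 < b\<close> by (simp add: powr_diff)
  have tangent: "?c * y \<le> y powr Q + ?d" if "0 \<le> y" for y
  proof (cases "y = 0")
    case True
    then show ?thesis using Q by simp
  next
    case False
    with that \<open>0 < b\<close> have pos: "0 < y powr Q" "0 < b powr Q" by auto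
    have "(y powr Q) powr (1 / Q) * (b powr Q) powr (1 - 1 / Q) \<le> 1 / Q * y powr Q + (1 - 1 / Q) * b powr Q"
      using Q pos by (intro Youngs_inequality_0) auto
    also have "(y powr Q) powr (1 / Q) * (b powr Q) powr (1 - 1 / Q) = y * b powr (Q - 1)"
      using Q that by (simp add: powr_powr right_diff_distrib)
    finally have "Q * (y * b powr (Q - 1)) \<le> Q * (1 / Q * y powr Q + (1 - 1 / Q) * b powr Q)"
      using Q by (intro mult_left_mono) auto
    also have "\<dots> = y powr Q + ?d" using Q by (simp add: algebra_simps)
    finally show ?thesis by (simp add: mult_ac)
  qed
  let ?X = "\<integral>\<^sup>+x. ennreal (k x powr Q) \<partial>N"
  have "ennreal (Q * b powr Q) = ennreal ?c * ennreal b"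
    using Q b pow by (simp add: ennreal_mult'[symmetric] mult.assoc)
  also have "\<dots> \<le> ennreal ?c * (\<integral>\<^sup>+x. ennreal (k x) \<partial>N)"
    by (intro mult_left_mono b) simp
  also have "\<dots> = (\<integral>\<^sup>+x. ennreal (?c * k x) \<partial>N)"
    using Q by (subst nn_integral_cmult[symmetric]) (auto simp: ennreal_mult')
  also have "\<dots> \<le> (\<integral>\<^sup>+x. ennreal (k x powr Q) + ennreal ?d \<partial>N)"
    using tangent[OF k] Q by (intro nn_integral_mono) (simp add: ennreal_leI flip: ennreal_plus)
  also have "\<dots> = ?X + ennreal ?d * emeasure N (space N)"
    by (subst nn_integral_add) auto
  also have "\<dots> \<le> ?X + ennreal ?d"
    using mult_left_mono[OF N, of "ennreal ?d"] by (intro add_left_mono) simp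
  finally have le: "ennreal (Q * b powr Q) \<le> ?X + ennreal ?d" .
  show ?thesis
  proof (cases ?X)
    case (real x)
    then have "Q * b powr Q \<le> x + ?d"
      using le Q by (simp flip: ennreal_plus)
    then show ?thesis using real by (simp add: algebra_simps ennreal_leI)
  qed simp
qed (use Q in simp)

text \<open>
  Minkowski's integral inequality.  Let \<open>W\<close> be the integral of \<open>w\<close> with respect to \<open>\<bar>dg\<bar>\<close>.  For almost
  every \<open>t\<close>, \<open>\<bar>g\<^sup>^(t)\<bar>\<close> is at most \<open>2 C (W + 1)\<close> times the mean of \<open>s \<mapsto> h\<^sub>s(t) / (C w(s))\<close> with respect
  to the measure \<open>w \<bar>dg\<bar> / (W + 1)\<close> of mass at most \<open>1\<close>.  By Jensen's inequality and Tonelli's theorem the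
  modular of this mean is controlled by the modulars of \<open>h\<^sub>s / (C w(s))\<close>, which are at most \<open>1\<close>.
\<close>

lemma Fourier_BV_in_Lvar:
  assumes pq: "exponent_function p" "conjugate_exponents p q"
    and bv: "bounded_variation g" and lim: "(g \<longlongrightarrow> 0) at_top" "(g \<longlongrightarrow> 0) at_bot"
    and w [measurable]: "w \<in> borel_measurable borel" and w_pos: "\<And>s. s \<noteq> 0 \<Longrightarrow> 0 < w s" and w_0: "w 0 = 0"
    and C: "0 < C"
    and le: "\<And>s. s \<noteq> 0 \<Longrightarrow> modular q (\<lambda>t. of_real (kbound s t / (C * w s))) \<le> 1"
    and fin: "(\<integral>\<^sup>+s. ennreal (w s) \<partial>variation_measure g) < \<infinity>"
  shows "Fourier_BV g \<in> Lvar q"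
proof -
  have qm [measurable]: "q \<in> borel_measurable lebesgue"
    by (rule measurable_conjugate_exponent[OF pq])
  have Fm [measurable]: "Fourier_BV g \<in> borel_measurable lebesgue"
    using borel_measurable_Fourier_BV[OF bv lim] by (intro measurable_completion) simp
  have w_nonneg: "0 \<le> w s" for s using w_pos[of s] w_0 by (cases "s = 0") auto
  let ?\<mu> = "variation_measure g"
  obtain W where W: "(\<integral>\<^sup>+s. ennreal (w s) \<partial>?\<mu>) = ennreal W" "0 \<le> W"
    using fin by (cases "\<integral>\<^sup>+s. ennreal (w s) \<partial>?\<mu>") auto
  \<comment> \<open>Dividing by \<open>W + 1\<close> instead of \<open>W\<close> avoids a separate treatment of \<open>W = 0\<close>.\<close>
  define K where "K = W + 1"
  have K: "0 < K" "W / K \<le> 1" using W(2) by (auto simp: K_def)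
  define N where "N = density ?\<mu> (\<lambda>s. ennreal (w s / K))"
  have [measurable_cong, simp]: "sets N = sets borel" and [simp]: "space N = UNIV"
    by (auto simp: N_def)
  have "emeasure N (space N) = (\<integral>\<^sup>+s. ennreal (1 / K) * ennreal (w s) \<partial>?\<mu>)"
    unfolding N_def using K by (simp add: emeasure_density ennreal_mult'[symmetric])
  also have "\<dots> = ennreal (1 / K) * ennreal W"
    by (subst nn_integral_cmult) (auto simp: W)
  also have "\<dots> \<le> 1"
    using K W(2) by (simp add: ennreal_mult'[symmetric])
  finally have N: "emeasure N (space N) \<le> 1" .
  then interpret N: finite_measure N
    by (intro finite_measureI) (auto simp: top_unique)
  interpret pair_sigma_finite "lebesgue :: real measure" N
    by (intro pair_sigma_finite.intro sigma_finite_lebesgue N.sigma_finite_measure_axioms)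
  define k where "k s t = kbound s t / (C * w s)" for s t
  have k_nonneg: "0 \<le> k s t" for s t
    using C w_nonneg by (simp add: k_def)
  have [measurable]: "fst \<in> borel_measurable ((lebesgue :: real measure) \<Otimes>\<^sub>M N)"
    by (rule measurable_compose[OF measurable_fst measurable_ident_lebesgue])
  have km [measurable]: "(\<lambda>x. k (snd x) (fst x)) \<in> borel_measurable (lebesgue \<Otimes>\<^sub>M N)"
    unfolding k_def kbound_def by measurable
  have qm2 [measurable]: "(\<lambda>x. q (fst x)) \<in> borel_measurable (lebesgue \<Otimes>\<^sub>M N)"
    by (rule measurable_compose[OF measurable_fst qm])
  have ks [measurable]: "(\<lambda>s. k s t) \<in> borel_measurable N" for t
    unfolding k_def by measurable
  define c where "c = 2 * (C * K)"
  have c: "0 < c" using C K by (simp add: c_def)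
  have mean: "ennreal (norm (Fourier_BV g t / of_real c)) \<le> (\<integral>\<^sup>+s. ennreal (k s t) \<partial>N)" if "t \<noteq> 0" for t
  proof -
    have "(\<integral>\<^sup>+s. ennreal (k s t) \<partial>N) = (\<integral>\<^sup>+s. ennreal (w s / K) * ennreal (k s t) \<partial>?\<mu>)"
      unfolding N_def k_def by (subst nn_integral_density) auto
    also have "\<dots> = (\<integral>\<^sup>+s. ennreal (1 / (C * K)) * ennreal (kbound s t) \<partial>?\<mu>)"
    proof (intro nn_integral_cong)
      fix s
      have "w s / K * k s t = 1 / (C * K) * kbound s t"
      proof (cases "s = 0")
        case True
        then show ?thesis by (simp add: w_0 kbound_def)
      next
        case False
        then show ?thesis using w_pos[of s] by (simp add: k_def)
      qed
      then show "ennreal (w s / K) * ennreal (k s t) = ennreal (1 / (C * K)) * ennreal (kbound s t)"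
        using k_nonneg C K by (simp add: ennreal_mult''[symmetric])
    qed
    also have "\<dots> = ennreal (1 / (C * K)) * (\<integral>\<^sup>+s. ennreal (kbound s t) \<partial>?\<mu>)"
      by (intro nn_integral_cmult) simp
    finally have eq: "(\<integral>\<^sup>+s. ennreal (k s t) \<partial>N) = ennreal (1 / (C * K)) * (\<integral>\<^sup>+s. ennreal (kbound s t) \<partial>?\<mu>)" .
    have "ennreal (norm (Fourier_BV g t / of_real c)) = ennreal (1 / c) * ennreal (norm (Fourier_BV g t))"
      using c by (simp add: norm_divide ennreal_mult'[symmetric])
    also have "\<dots> \<le> ennreal (1 / c) * (2 * (\<integral>\<^sup>+s. ennreal (kbound s t) \<partial>?\<mu>))"
      by (intro mult_left_mono norm_Fourier_BV_le[OF bv that lim]) simp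
    also have "\<dots> = ennreal (1 / c * 2) * (\<integral>\<^sup>+s. ennreal (kbound s t) \<partial>?\<mu>)"
      by (subst ennreal_mult'') (simp_all add: mult.assoc)
    also have "1 / c * 2 = 1 / (C * K)" by (simp add: c_def)
    finally show ?thesis unfolding eq .
  qed
  have "modular q (\<lambda>t. Fourier_BV g t / of_real c) \<le> 1 + 1"
  proof (rule modular_le[OF qm])
    let ?G = "\<lambda>t s. ennreal (k s t powr enn2real (q t)) * indicator {t. q t \<noteq> \<infinity>} t"
    show "(\<lambda>t. Fourier_BV g t / of_real c) \<in> borel_measurable lebesgue" by measurable
    show "AE t in lebesgue. q t \<noteq> \<infinity> \<longrightarrow>
        ennreal (norm (Fourier_BV g t / of_real c) powr enn2real (q t)) \<le> (\<integral>\<^sup>+s. ?G t s \<partial>N)"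
      using AE_lebesgue_nonzero
    proof (eventually_elim, intro impI)
      fix t :: real assume t: "t \<noteq> 0" "q t \<noteq> \<infinity>"
      have Q: "1 \<le> enn2real (q t)"
        by (rule inv_exponent_eq(1)[of q t, OF conjugate_exponents_ge_one[OF pq(2)] t(2)])
      have "(\<integral>\<^sup>+s. ?G t s \<partial>N) = (\<integral>\<^sup>+s. ennreal (k s t powr enn2real (q t)) \<partial>N)"
        using t(2) by simp
      then show "ennreal (norm (Fourier_BV g t / of_real c) powr enn2real (q t)) \<le> (\<integral>\<^sup>+s. ?G t s \<partial>N)"
        using powr_le_nn_integral_powr[OF N ks k_nonneg Q norm_ge_zero mean[OF t(1)]] by simp
    qed
    have "(\<integral>\<^sup>+t. (\<integral>\<^sup>+s. ?G t s \<partial>N) \<partial>lebesgue) = (\<integral>\<^sup>+s. (\<integral>\<^sup>+t. ?G t s \<partial>lebesgue) \<partial>N)"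
      by (rule Fubini'[symmetric]) (simp add: case_prod_beta', measurable)
    also have "\<dots> \<le> (\<integral>\<^sup>+s. 1 \<partial>N)"
    proof (rule nn_integral_mono)
      fix s
      show "(\<integral>\<^sup>+t. ?G t s \<partial>lebesgue) \<le> 1"
      proof (cases "s = 0")
        case True
        then show ?thesis by (simp add: k_def kbound_def)
      next
        case False
        have "(\<integral>\<^sup>+t. ?G t s \<partial>lebesgue) \<le> modular q (\<lambda>t. of_real (k s t))"
          unfolding modular_def norm_of_real abs_of_nonneg[OF k_nonneg] by simp
        also have "\<dots> \<le> 1" unfolding k_def by (rule le[OF False])
        finally show ?thesis .
      qed
    qed
    also have "\<dots> \<le> 1" using N by simp
    finally show "(\<integral>\<^sup>+t. (\<integral>\<^sup>+s. ?G t s \<partial>N) \<partial>lebesgue) \<le> 1" .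
    \<comment> \<open>The null set of \<open>t\<close> depends on \<open>s\<close>; Fubini's theorem for null sets exchanges the quantifiers.\<close>
    have "AE s in N. AE t in lebesgue. q t = \<infinity> \<longrightarrow> k s t \<le> 1"
    proof (rule AE_I2)
      fix s
      show "AE t in lebesgue. q t = \<infinity> \<longrightarrow> k s t \<le> 1"
      proof (cases "s = 0")
        case False
        have "modular q (\<lambda>t. of_real (k s t)) \<le> ennreal 1"
          unfolding k_def using le[OF False] by simp
        from AE_norm_le_of_modular[OF qm this] show ?thesis
          by (simp add: abs_of_nonneg[OF k_nonneg])
      qed (simp add: k_def kbound_def)
    qed
    moreover have AE_meas: "{x \<in> space (lebesgue \<Otimes>\<^sub>M N). q (fst x) = \<infinity> \<longrightarrow> k (snd x) (fst x) \<le> 1}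
        \<in> sets (lebesgue \<Otimes>\<^sub>M N)"
      by measurable
    ultimately have "AE t in lebesgue. AE s in N. q t = \<infinity> \<longrightarrow> k s t \<le> 1"
      by (subst AE_commute[OF AE_meas])
    then show "AE t in lebesgue. q t = \<infinity> \<longrightarrow> ennreal (norm (Fourier_BV g t / of_real c)) \<le> 1"
      using AE_lebesgue_nonzero
    proof (eventually_elim, intro impI)
      fix t assume AE: "AE s in N. q t = \<infinity> \<longrightarrow> k s t \<le> 1" and "t \<noteq> 0" "q t = \<infinity>"
      have "(\<integral>\<^sup>+s. ennreal (k s t) \<partial>N) \<le> (\<integral>\<^sup>+s. 1 \<partial>N)"
        using AE \<open>q t = \<infinity>\<close> by (intro nn_integral_mono_AE) auto
      also have "\<dots> \<le> 1" using N by simp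
      finally show "ennreal (norm (Fourier_BV g t / of_real c)) \<le> 1"
        by (rule order_trans[OF mean[OF \<open>t \<noteq> 0\<close>]])
    qed
  qed
  also have "\<dots> < \<infinity>" by simp
  finally show ?thesis
    using c unfolding Lvar_def by auto
qed

text \<open>
  \<open>\<bar>x\<bar>\<^sup>m \<bar>g(x)\<bar>\<close> is at most the integral of \<open>\<bar>s\<bar>\<^sup>m\<close> with respect to \<open>\<bar>dg(s)\<bar>\<close> over \<open>\<bar>s\<bar> \<ge> \<bar>x\<bar>\<close>, a tail of a
  convergent integral.
\<close>

lemma bounded_variation_smallo_powr:
  assumes bv: "bounded_variation g" and lim: "(g \<longlongrightarrow> 0) at_top" "(g \<longlongrightarrow> 0) at_bot"
    and m: "0 \<le> m" and fin: "(\<integral>\<^sup>+s. ennreal (\<bar>s\<bar> powr m) \<partial>variation_measure g) < \<infinity>"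
  shows "(\<lambda>x. norm (g x)) \<in> o[at_infinity](\<lambda>x. \<bar>x\<bar> powr - m)"
proof (rule landau_o.smallI)
  fix e :: real assume e: "0 < e"
  let ?\<mu> = "variation_measure g"
  interpret finite_measure ?\<mu> by (rule finite_variation_measure[OF bv])
  let ?N = "density ?\<mu> (\<lambda>s. ennreal (\<bar>s\<bar> powr m))"
  interpret N: finite_measure ?N
    by (rule finite_measureI) (use fin in \<open>simp add: emeasure_density\<close>)
  obtain B where B: "0 < B" "measure ?N {s. B \<le> \<bar>s\<bar>} < e"
    using finite_measure_tail_small[OF N.finite_measure_axioms _ e] by auto
  show "\<forall>\<^sub>F x in at_infinity. norm (norm (g x)) \<le> e * norm (\<bar>x\<bar> powr - m)"
  proof (rule eventually_at_infinityI)
    fix x :: real assume "B \<le> norm x"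
    then have x: "B \<le> \<bar>x\<bar>" "0 < \<bar>x\<bar>" using B(1) by auto
    let ?A = "{s. \<bar>x\<bar> \<le> \<bar>s\<bar>}"
    have "ennreal (\<bar>x\<bar> powr m * measure ?\<mu> ?A) = ennreal (\<bar>x\<bar> powr m) * emeasure ?\<mu> ?A"
      by (simp add: emeasure_eq_measure ennreal_mult')
    also have "\<dots> = (\<integral>\<^sup>+s. ennreal (\<bar>x\<bar> powr m) * indicator ?A s \<partial>?\<mu>)"
      by (rule nn_integral_cmult_indicator[symmetric]) simp
    also have "\<dots> \<le> (\<integral>\<^sup>+s. ennreal (\<bar>s\<bar> powr m) * indicator ?A s \<partial>?\<mu>)"
      using m by (intro nn_integral_mono) (auto simp: indicator_def intro!: ennreal_leI powr_mono2)
    also have "\<dots> = emeasure ?N ?A" by (simp add: emeasure_density)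
    finally have "\<bar>x\<bar> powr m * measure ?\<mu> ?A \<le> measure ?N ?A"
      by (simp add: N.emeasure_eq_measure)
    also have "\<dots> \<le> measure ?N {s. B \<le> \<bar>s\<bar>}"
      using x by (intro N.finite_measure_mono) auto
    finally have "\<bar>x\<bar> powr m * measure ?\<mu> ?A \<le> e" using B(2) by simp
    moreover have "\<bar>x\<bar> powr m * norm (g x) \<le> \<bar>x\<bar> powr m * measure ?\<mu> ?A"
      by (intro mult_left_mono norm_le_variation_tail bv lim) simp
    ultimately have "\<bar>x\<bar> powr m * norm (g x) \<le> e" by linarith
    then show "norm (norm (g x)) \<le> e * norm (\<bar>x\<bar> powr - m)"
      using x(2) by (simp add: powr_minus field_simps)
  qed
qed

section \<open>The exchange formula\<close>

lemma nn_integral_kbound_mult_le: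
  assumes pq: "exponent_function p" "conjugate_exponents p q"
    and f: "f \<in> borel_measurable lebesgue" and l: "0 < l" "modular p (\<lambda>t. f t / of_real l) \<le> 1"
    and c: "0 < c" "modular q (\<lambda>t. of_real (kbound s t / c)) \<le> 1"
  shows "(\<integral>\<^sup>+t. ennreal (kbound s t * norm (f t)) \<partial>lebesgue) \<le> ennreal (2 * l * c)"
proof -
  note [measurable] = f measurable_lebesgue_kbound
  have "(\<integral>\<^sup>+t. ennreal (kbound s t * norm (f t)) \<partial>lebesgue) =
      (\<integral>\<^sup>+t. ennreal (l * c) * ennreal (norm (complex_of_real (kbound s t / c)) * norm (f t / of_real l)) \<partial>lebesgue)"
    using l(1) c(1) by (intro nn_integral_cong)
      (simp add: norm_divide ennreal_mult'[symmetric] abs_of_nonneg[OF kbound_nonneg])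
  also have "\<dots> = ennreal (l * c) *
      (\<integral>\<^sup>+t. ennreal (norm (complex_of_real (kbound s t / c)) * norm (f t / of_real l)) \<partial>lebesgue)"
    by (intro nn_integral_cmult) measurable
  also have "\<dots> \<le> ennreal (l * c) * 2"
    by (intro mult_left_mono Hoelder_variable_exponent[OF pq _ l(2) _ c(2)]) measurable
  also have "\<dots> = ennreal (2 * l * c)"
    using l c by (simp add: ennreal_mult' mult_ac)
  finally show ?thesis .
qed

text \<open>
  The constants are \<open>M = 1\<close> and \<open>K\<^sub>1 = K\<^sub>2 = 4 C\<close>, with \<open>C\<close> and \<open>r\<close> from \<open>modular_kbound_le\<close>: one factor
  \<open>2\<close> stems from Hoelder's inequality, the other one from atoms of the variation measure at common end
  points of intervals.
\<close>

theorem theorem6p2: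
  fixes p q :: "real \<Rightarrow> ennreal"
  assumes "exponent_function p"
    and "esssup lebesgue p < \<infinity> \<or> log_Hoelder_at_infinity p 1"
    and "conjugate_exponents p q"
  shows "(\<forall>f g. f \<in> Lvar p \<longrightarrow> admissible_BV p g \<longrightarrow>
            (\<forall>t. t \<noteq> 0 \<longrightarrow> (\<lambda>s. exp (- \<i> * of_real s * of_real t) * g s) integrable_on UNIV) \<and>
            Fourier_BV g \<in> Lvar q \<and>
            Fourier_pairing_defined p f g \<and>
            integrable lebesgue (\<lambda>s. f s * Fourier_BV g s) \<and>
            Fourier_pairing f g = (LINT s|lebesgue. f s * Fourier_BV g s)) \<and>
         (\<exists>K\<^sub>1 K\<^sub>2 M r :: real. K\<^sub>1 > 0 \<and> K\<^sub>2 > 0 \<and> M > 0 \<and> r \<ge> 1 \<and>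
            (\<forall>f g. f \<in> Lvar p \<longrightarrow> admissible_BV p g \<longrightarrow>
               ennreal (norm (Fourier_pairing f g)) \<le>
                 ennreal (Lvar_norm p f) *
                 (ennreal K\<^sub>1 * (\<integral>\<^sup>+s\<in>{s. \<bar>s\<bar> \<le> M}. ennreal (\<bar>s\<bar> powr (1 / r)) \<partial>variation_measure g) +
                  ennreal K\<^sub>2 * (\<integral>\<^sup>+s\<in>{s. M < \<bar>s\<bar>}. ennreal (\<bar>s\<bar> powr inv_p_minus p) \<partial>variation_measure g))))"
proof -
  let ?m = "inv_p_minus p"
  obtain C r where C: "0 < C" and r: "1 \<le> r"
    and key_le: "\<And>s. s \<noteq> 0 \<Longrightarrow> modular q (\<lambda>t. of_real (kbound s t / (C * weight r ?m s))) \<le> 1"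
    using modular_kbound_le[OF assms(1,3,2)] by metis
  define w where "w = weight r ?m"
  note key = key_le[folded w_def]
  have weight_facts: "0 \<le> w s" "s \<noteq> 0 \<Longrightarrow> 0 < w s" "w 0 = 0" for s
    by (auto simp: w_def weight_pos)
  have wm [measurable]: "w \<in> borel_measurable borel" by (simp add: w_def)
  have m: "0 \<le> ?m" by (simp add: inv_p_minus_def)

  have split: "(\<integral>\<^sup>+s. ennreal (w s) \<partial>variation_measure g) =
      (\<integral>\<^sup>+s\<in>{s. \<bar>s\<bar> \<le> 1}. ennreal (\<bar>s\<bar> powr (1 / r)) \<partial>variation_measure g) +
      (\<integral>\<^sup>+s\<in>{s. 1 < \<bar>s\<bar>}. ennreal (\<bar>s\<bar> powr ?m) \<partial>variation_measure g)" for g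
    by (subst nn_integral_add[symmetric])
      (auto intro!: nn_integral_cong simp: w_def weight_def indicator_def)

  have w_fin: "(\<integral>\<^sup>+s. ennreal (w s) \<partial>variation_measure g) < \<infinity>" if g: "admissible_BV p g" for g
  proof -
    interpret finite_measure "variation_measure g"
      using g by (intro finite_variation_measure) (simp add: admissible_BV_def)
    have "(\<integral>\<^sup>+s. ennreal (w s) \<partial>variation_measure g) \<le>
        (\<integral>\<^sup>+s. 1 + ennreal (\<bar>s\<bar> powr ?m) \<partial>variation_measure g)"
      using r by (intro nn_integral_mono)
        (auto simp: w_def weight_def powr_le1 intro!: add_increasing2)
    also have "\<dots> = emeasure (variation_measure g) UNIV + (\<integral>\<^sup>+s. ennreal (\<bar>s\<bar> powr ?m) \<partial>variation_measure g)"
      by (subst nn_integral_add) auto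
    also have "\<dots> < \<infinity>"
      using g emeasure_finite by (simp add: admissible_BV_def less_top[symmetric])
    finally show ?thesis .
  qed

  have core: "kernel_bounded_pairing f g (2 * l * C) w"
    if f: "f \<in> Lvar p" and g: "admissible_BV p g" and l: "0 < l" "modular p (\<lambda>t. f t / of_real l) \<le> 1" for f g l
  proof
    show fm: "f \<in> borel_measurable lebesgue" using f by (simp add: Lvar_def)
    show "(w \<longlongrightarrow> 0) (at_right 0)" unfolding w_def using r by (intro weight_tendsto_0) simp
    show "(\<integral>\<^sup>+t. ennreal (kbound s t * norm (f t)) \<partial>lebesgue) \<le> ennreal (2 * l * C * w s)" for s
    proof (cases "s = 0")
      case True
      then show ?thesis by (simp add: kbound_def)
    next
      case False
      from nn_integral_kbound_mult_le[OF assms(1,3) fm l _ key[OF this]]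
      show ?thesis using C weight_facts(2)[OF False] by (simp add: mult.assoc)
    qed
  qed (use g l C weight_facts w_fin in \<open>auto simp: admissible_BV_def\<close>)

  have "(\<forall>t. t \<noteq> 0 \<longrightarrow> (\<lambda>s. exp (- \<i> * of_real s * of_real t) * g s) integrable_on UNIV) \<and>
      Fourier_BV g \<in> Lvar q \<and> Fourier_pairing_defined p f g \<and>
      integrable lebesgue (\<lambda>s. f s * Fourier_BV g s) \<and>
      Fourier_pairing f g = (LINT s|lebesgue. f s * Fourier_BV g s)"
    if f: "f \<in> Lvar p" and g: "admissible_BV p g" for f g
  proof (intro conjI allI impI)
    obtain l where l: "0 < l" "modular p (\<lambda>t. f t / of_real l) \<le> 1"
      using Lvar_scale[OF assms(1) f] .
    interpret kernel_bounded_pairing f g "2 * l * C" w by (rule core[OF f g l])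
    show "(\<lambda>s. exp (- \<i> * of_real s * of_real t) * g s) integrable_on UNIV" if "t \<noteq> 0" for t
      by (rule Fourier_BV_integrable_on[OF bv that lim])
    show "Fourier_BV g \<in> Lvar q"
      by (rule Fourier_BV_in_Lvar[OF assms(1,3) bv lim wm weight_facts(2,3) C key w_fin[OF g]])
    show "Fourier_pairing_defined p f g"
      using g has_HS_integral_Fourier_primitive bounded_variation_smallo_powr[OF bv lim m]
      unfolding Fourier_pairing_defined_def HS_integrable_def admissible_BV_def by blast
    show "integrable lebesgue (\<lambda>s. f s * Fourier_BV g s)"
      using integrable_Fourier_BV_mult_f by (simp add: mult.commute)
    show "Fourier_pairing f g = (LINT s|lebesgue. f s * Fourier_BV g s)"
      by (rule Fourier_pairing_eq)
  qed

  moreover have "ennreal (norm (Fourier_pairing f g)) \<le> ennreal (Lvar_norm p f) *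
      (ennreal (4 * C) * (\<integral>\<^sup>+s\<in>{s. \<bar>s\<bar> \<le> 1}. ennreal (\<bar>s\<bar> powr (1 / r)) \<partial>variation_measure g) +
       ennreal (4 * C) * (\<integral>\<^sup>+s\<in>{s. 1 < \<bar>s\<bar>}. ennreal (\<bar>s\<bar> powr ?m) \<partial>variation_measure g))"
    if f: "f \<in> Lvar p" and g: "admissible_BV p g" for f g
  proof -
    let ?S = "{l. l > 0 \<and> modular p (\<lambda>t. f t / of_real l) \<le> 1}"
    obtain W where W: "(\<integral>\<^sup>+s. ennreal (w s) \<partial>variation_measure g) = ennreal W" "0 \<le> W"
      using w_fin[OF g] by (cases "\<integral>\<^sup>+s. ennreal (w s) \<partial>variation_measure g") auto
    let ?c = "4 * C * W"
    \<comment> \<open>The estimate holds for every \<open>l\<close> in the set that defines the norm of \<open>f\<close>, hence for their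
       infimum, which need not be attained.\<close>
    have le: "norm (Fourier_pairing f g) \<le> l * ?c" if "l \<in> ?S" for l
    proof -
      have l: "0 < l" "modular p (\<lambda>t. f t / of_real l) \<le> 1" using that by auto
      interpret kernel_bounded_pairing f g "2 * l * C" w by (rule core[OF f g l])
      have "ennreal (norm (Fourier_pairing f g)) \<le> 2 * (ennreal (2 * l * C) * ennreal W)"
        using norm_integral_Fourier_BV_le W(1) unfolding Fourier_pairing_eq by (simp add: mult.commute)
      also have "\<dots> = ennreal (l * ?c)"
        using l(1) C W(2) by (simp add: ennreal_mult'[symmetric] mult_ac flip: ennreal_numeral)
      finally show ?thesis
        using l(1) C W(2) by (subst (asm) ennreal_le_iff) auto
    qed
    have ne: "?S \<noteq> {}" using Lvar_scale[OF assms(1) f] by blast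
    have "norm (Fourier_pairing f g) \<le> Lvar_norm p f * ?c"
    proof (cases "?c = 0")
      case True
      with ne le show ?thesis by auto
    next
      case False
      with C W(2) have c: "0 < ?c" by simp
      have "norm (Fourier_pairing f g) / ?c \<le> Inf ?S"
        using le c by (intro cInf_greatest ne) (simp add: pos_divide_le_eq)
      then show ?thesis using c by (simp add: Lvar_norm_def pos_divide_le_eq)
    qed
    then have "ennreal (norm (Fourier_pairing f g)) \<le> ennreal (Lvar_norm p f * ?c)"
      by (rule ennreal_leI)
    also have "\<dots> = ennreal (Lvar_norm p f) * (ennreal (4 * C) * ennreal W)"
      using C W(2) by (simp add: ennreal_mult'')
    finally show ?thesis unfolding W(1)[symmetric] split distrib_left .
  qed
  ultimately show ?thesis
    using C r by (intro conjI exI[of _ "4 * C"] exI[of _ 1] exI[of _ r]) auto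
qed

end
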